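(* Let $\alpha$ and $\beta$ be countable nonzero ordinals, and let $k>1$ be a positive integer. If \[\omega^{\omega^\alpha}\to_{top}(\omega^\beta,k)^2,\] then \[\omega^{\omega^\alpha\cdot\beta}\to_{top}(\omega^\beta,k+1)^2.\]
   Context: All arithmetic operations on ordinals are in the ordinal sense. Every ordinal is identified with the set of smaller ordinals and carries the order topology; subsets carry the subspace topology. $[X]^2$ is the set of $2$-element subsets of $X$. For ordinals $\delta,\mu$ and a positive integer $k$, $\delta\to_{top}(\mu,k)^2$ means: for every coloring $c:[\delta]^2\to\{\text{red},\text{blue}\}$ (an arbitrary function), either there is a subspace $X\subseteq\delta$ homeomorphic to $\mu$ with every element of $[X]^2$ colored red, or there is a subset $Y\subseteq\delta$ with exactly $k$ elements with every element of $[Y]^2$ colored blue. *)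

theory Defs
  imports "HOL-Analysis.Function_Topology" "HOL-Library.Ramsey"
begin

section \<open>Countable ordinals\<close>

text \<open>
  A countable ordinal is the order type of a well-order on a subset of \<^typ>\<open>nat\<close>.
  The relations \<^const>\<open>ordIso\<close>, \<^const>\<open>ordLeq\<close> and \<^const>\<open>ordLess\<close> hold only between
  well-orders, so the equivalence below is partial.  The ordinal \<open>\<delta>\<close>, seen as the set of
  smaller ordinals, is \<open>{..<\<delta>}\<close>.
\<close>

quotient_type cord = "nat rel" / partial: "\<lambda>r s. (r, s) \<in> ordIso"
proof (rule part_equivpI)
  show "\<exists>r::nat rel. (r, r) \<in> ordIso"
    using ordIso_reflexive natLeq_Well_order by blast
  show "symp (\<lambda>r s :: nat rel. (r, s) \<in> ordIso)"
    by (auto intro: sympI ordIso_symmetric)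
  show "transp (\<lambda>r s :: nat rel. (r, s) \<in> ordIso)"
    by (auto intro: transpI ordIso_transitive)
qed

lemma ordIso_refl_iff: "(r, r) \<in> ordIso \<longleftrightarrow> Well_order r"
  using ordIso_reflexive by (auto simp: ordIso_def)

instantiation cord :: wellorder
begin

lift_definition less_eq_cord :: "cord \<Rightarrow> cord \<Rightarrow> bool" is "\<lambda>r s. (r, s) \<in> ordLeq"
  by (meson ordIso_ordLeq_trans ordIso_symmetric ordLeq_ordIso_trans)

lift_definition less_cord :: "cord \<Rightarrow> cord \<Rightarrow> bool" is "\<lambda>r s. (r, s) \<in> ordLess"
  by (meson ordIso_ordLess_trans ordIso_symmetric ordLess_ordIso_trans)

instance
proof
  fix x y z :: cord
  show "x < y \<longleftrightarrow> x \<le> y \<and> \<not> y \<le> x"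
  proof transfer
    fix r s :: "nat rel"
    assume "(r, r) \<in> ordIso" "(s, s) \<in> ordIso"
    then have "(r, s) \<in> ordLess \<longleftrightarrow> (s, r) \<notin> ordLeq"
      using not_ordLeq_iff_ordLess unfolding ordIso_refl_iff by blast
    then show "(r, s) \<in> ordLess \<longleftrightarrow> (r, s) \<in> ordLeq \<and> (s, r) \<notin> ordLeq"
      using ordLess_imp_ordLeq by blast
  qed
  show "x \<le> x"
    by transfer (simp add: ordIso_imp_ordLeq)
  show "x \<le> y \<Longrightarrow> y \<le> z \<Longrightarrow> x \<le> z"
    by transfer (rule ordLeq_transitive)
  show "x \<le> y \<Longrightarrow> y \<le> x \<Longrightarrow> x = y"
    by transfer (simp add: ordIso_iff_ordLeq)
  show "x \<le> y \<or> y \<le> x"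
    by transfer (meson ordIso_refl_iff ordLeq_total)
next
  fix P :: "cord \<Rightarrow> bool" and a :: cord
  assume step: "\<And>x. (\<And>y. y < x \<Longrightarrow> P y) \<Longrightarrow> P x"
  have eq: "{(x, y). x < y} = inv_image ordLess rep_cord"
    by (auto simp: less_cord.rep_eq inv_image_def)
  have "wf {(x, y :: cord). x < y}"
    unfolding eq by (rule wf_inv_image[OF wf_ordLess])
  then show "P a"
    by (induction a rule: wf_induct_rule) (simp add: step)
qed

end

lemma ordIso_rep_rep: "(rep_cord x, rep_cord x) \<in> ordIso"
  by (rule Quotient3_rep_reflp[OF Quotient3_cord])

lemma Well_order_rep_cord: "Well_order (rep_cord x)"
  using ordIso_rep_rep ordIso_refl_iff by blast

lemma abs_rep_cord: "abs_cord (rep_cord x) = x"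
  by (rule Quotient3_abs_rep[OF Quotient3_cord])

lemma Well_order_le: "Well_order {(a :: cord, b). a \<le> b}"
proof -
  let ?R = "{(a :: cord, b). a \<le> b}"
  have F: "Field ?R = UNIV"
    by (auto simp: Field_def)
  have "?R - Id = {(a, b). a < b}"
    by auto
  then have "wf (?R - Id)"
    by (simp only: wf)
  moreover have "refl ?R" "trans ?R" "antisym ?R" "total ?R"
    by (auto intro!: refl_onI transI antisymI simp: total_on_def)
  ultimately show ?thesis
    by (simp add: F order_on_defs)
qed

definition seg :: "cord \<Rightarrow> cord rel"
  where "seg x = {(a, b). a \<le> b \<and> b < x}"

lemma Field_seg: "Field (seg x) = {..<x}"
  by (auto simp: Field_def seg_def)

lemma seg_conv_Restr: "seg x = Restr {(a, b). a \<le> b} (underS {(a, b). a \<le> b} x)"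
  by (auto simp: seg_def underS_def)

lemma Well_order_seg: "Well_order (seg x)"
  unfolding seg_conv_Restr by (rule Well_order_Restr[OF Well_order_le])

lemma ordIso_seg_abs:
  assumes r: "Well_order (r :: nat rel)"
  shows "(r, seg (abs_cord r)) \<in> ordIso"
proof -
  let ?u = "\<lambda>i. Restr r (underS r i)"
  let ?f = "\<lambda>i. abs_cord (?u i)"
  have wu: "Well_order (?u i)" for i
    using r by (rule Well_order_Restr)
  have le: "abs_cord s \<le> abs_cord t \<longleftrightarrow> (s, t) \<in> ordLeq"
    if "Well_order s" "Well_order t" for s t
    using that by (simp add: less_eq_cord.abs_eq ordIso_reflexive)
  have lt: "abs_cord s < abs_cord t \<longleftrightarrow> (s, t) \<in> ordLess"
    if "Well_order s" "Well_order t" for s t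
    using that by (simp add: less_cord.abs_eq ordIso_reflexive)
  have wo: "wo_rel r"
    using r by (simp add: wo_rel_def)
  have ord: "(i, j) \<in> r \<longleftrightarrow> ?f i \<le> ?f j" if "i \<in> Field r" "j \<in> Field r" for i j
  proof -
    have "?f i \<le> ?f j \<longleftrightarrow> underS r i \<subseteq> underS r j"
      using le[OF wu wu] ofilter_subset_ordLeq[OF r] wo_rel.underS_ofilter[OF wo] by blast
    also have "\<dots> \<longleftrightarrow> (i, j) \<in> r"
      using that r by (simp add: underS_incl_iff order_on_defs)
    finally show ?thesis ..
  qed
  have lt_r: "?f i < abs_cord r" if "i \<in> Field r" for i
    using that lt[OF wu r] underS_Restr_ordLess[OF r] by blast
  have onto: "\<exists>i\<in>Field r. y = ?f i" if y: "y < abs_cord r" for y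
  proof -
    have "(rep_cord y, r) \<in> ordLess"
      using y lt[OF Well_order_rep_cord r, of y] by (simp add: abs_rep_cord)
    then obtain i where i: "i \<in> Field r" "(rep_cord y, ?u i) \<in> ordIso"
      using ordLess_iff_ordIso_Restr[OF r Well_order_rep_cord] by blast
    then have "y = ?f i"
      using Quotient3_rel_abs[OF Quotient3_cord] abs_rep_cord by metis
    with i show ?thesis by blast
  qed
  have "inj_on ?f (Field r)"
  proof (rule inj_onI)
    fix i j assume "i \<in> Field r" "j \<in> Field r" "?f i = ?f j"
    then have "(i, j) \<in> r" "(j, i) \<in> r"
      using ord by auto
    then show "i = j"
      using wo_rel.ANTISYM[OF wo] by (auto dest: antisymD)
  qed
  moreover have "?f ` Field r = {..<abs_cord r}"
    using lt_r onto by auto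
  ultimately have "iso r (seg (abs_cord r)) ?f"
    unfolding iso_iff2 Field_seg bij_betw_def
    using ord lt_r by (auto simp: seg_def)
  then show ?thesis
    using r Well_order_seg unfolding ordIso_def by blast
qed

lemma ordIso_rep_cord: "(rep_cord x, seg x) \<in> ordIso"
  using ordIso_seg_abs[OF Well_order_rep_cord, of x] by (simp add: abs_rep_cord)

lemma countable_lessThan_cord: "countable {..<x :: cord}"
proof -
  obtain f where "bij_betw f (Field (rep_cord x)) {..<x}"
    using ordIso_rep_cord[of x] by (auto simp: ordIso_def iso_def Field_seg)
  then show ?thesis
    by (metis bij_betw_imp_surj_on countable_image countableI_type)
qed

text \<open>Every countable well-order is represented.\<close>

lemma ex_cord_ordIso:
  fixes s :: "'a rel"
  assumes s: "Well_order s" and c: "countable (Field s)"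
  shows "\<exists>x. (s, seg x) \<in> ordIso"
proof -
  let ?g = "to_nat_on (Field s)"
  have inj: "inj_on ?g (Field s)"
    using c by (rule inj_on_to_nat_on)
  have "(s, dir_image s ?g) \<in> ordIso"
    using s inj by (rule dir_image_ordIso)
  moreover have "(dir_image s ?g, seg (abs_cord (dir_image s ?g))) \<in> ordIso"
    by (rule ordIso_seg_abs[OF Well_order_dir_image[OF s inj]])
  ultimately show ?thesis
    by (meson ordIso_transitive)
qed

lemma ex_greater_cord:
  assumes A: "countable (A :: cord set)"
  shows "\<exists>b. \<forall>a\<in>A. a < b"
proof (rule ccontr)
  assume "\<not> ?thesis"
  then have "UNIV = (\<Union>a\<in>A. {..<a}) \<union> A"
    by (auto simp: not_less order_le_less)
  moreover have "countable ((\<Union>a\<in>A. {..<a}) \<union> A)"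
    using A by (auto intro: countable_lessThan_cord)
  ultimately have c: "countable (UNIV :: cord set)"
    by simp
  let ?R = "{(a :: cord, b). a \<le> b}"
  obtain x where x: "(?R, seg x) \<in> ordIso"
    using ex_cord_ordIso[OF Well_order_le countable_subset[OF subset_UNIV c]] by blast
  have "(seg x, ?R) \<in> ordLess"
    unfolding seg_conv_Restr
    by (rule underS_Restr_ordLess[OF Well_order_le]) (auto simp: Field_def)
  then show False
    using x by (meson not_ordLess_ordIso ordIso_symmetric)
qed

section \<open>Ordinal arithmetic\<close>

definition succ :: "cord \<Rightarrow> cord"
  where "succ x = (LEAST y. x < y)"

definition lub :: "cord set \<Rightarrow> cord"
  where "lub A = (LEAST b. \<forall>a\<in>A. a \<le> b)"

instantiation cord :: "{zero, one}"
begin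

lift_definition zero_cord :: cord is "{}"
  by (simp add: ordIso_refl_iff)

definition one_cord :: cord
  where "one_cord = succ 0"

instance ..

end

lift_definition \<omega> :: cord is natLeq
  by (simp add: ordIso_refl_iff natLeq_Well_order)

lemma less_succ: "x < succ x"
  unfolding succ_def using ex_greater_cord[of "{x}"] by (auto intro: LeastI_ex)

lemma succ_le_iff: "succ x \<le> y \<longleftrightarrow> x < y"
  using less_succ[of x] Least_le[of "\<lambda>y. x < y" y] by (auto simp: succ_def)

lemma less_succ_iff: "y < succ x \<longleftrightarrow> y \<le> x"
  using succ_le_iff[of x y] by (simp add: linorder_not_le[symmetric])

lemma succ_inject [simp]: "succ x = succ y \<longleftrightarrow> x = y"
  by (metis less_succ_iff order_refl order_antisym)

lemma lub_le_iff: "countable A \<Longrightarrow> lub A \<le> b \<longleftrightarrow> (\<forall>a\<in>A. a \<le> b)"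
proof -
  assume "countable A"
  then have "\<exists>b. \<forall>a\<in>A. a \<le> b"
    using ex_greater_cord[of A] less_imp_le by blast
  then have "\<forall>a\<in>A. a \<le> lub A"
    unfolding lub_def by (rule LeastI_ex)
  moreover have "lub A \<le> b" if "\<forall>a\<in>A. a \<le> b"
    unfolding lub_def using that by (rule Least_le)
  ultimately show ?thesis
    by (meson order_trans)
qed

lemma zero_le_cord [simp]: "0 \<le> (x :: cord)"
proof -
  have "seg 0 = {}"
    using ordIso_seg_abs[of "{}"]
    by (auto simp: zero_cord_def ordIso_def iso_def bij_betw_def Field_def)
  then have "{..<0 :: cord} = {}"
    using Field_seg[of 0] by (simp add: Field_def)
  then show ?thesis
    by (metis empty_iff lessThan_iff linorder_not_le)
qed

lemma succ_neq_zero [simp]: "succ x \<noteq> 0"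
  using less_succ[of x] zero_le_cord[of x] by (metis linorder_not_le)

definition is_limit :: "cord \<Rightarrow> bool"
  where "is_limit x \<longleftrightarrow> x \<noteq> 0 \<and> (\<nexists>y. x = succ y)"

text \<open>Every countable set of countable ordinals is bounded (\<open>ex_greater_cord\<close>), so the
  suprema below are genuine.\<close>

function ord_rec :: "cord \<Rightarrow> (cord \<Rightarrow> cord) \<Rightarrow> cord \<Rightarrow> cord" where
  "ord_rec z s x =
    (if x = 0 then z
     else if \<exists>y. x = succ y then s (ord_rec z s (THE y. x = succ y))
     else lub ((\<lambda>y. ord_rec z s y) ` {..<x}))"
  by auto
termination
  by (relation "inv_image {(x, y). x < y} (\<lambda>(z, s, x). x)")
    (auto intro!: wf_inv_image simp: wf less_succ)

declare ord_rec.simps [simp del]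

lemma ord_rec_0: "ord_rec z s 0 = z"
  by (subst ord_rec.simps) simp

lemma ord_rec_succ: "ord_rec z s (succ x) = s (ord_rec z s x)"
  by (subst ord_rec.simps) simp

lemma ord_rec_limit: "is_limit x \<Longrightarrow> ord_rec z s x = lub (ord_rec z s ` {..<x})"
  by (subst ord_rec.simps) (simp add: is_limit_def)

instantiation cord :: "{plus, times}"
begin

definition plus_cord :: "cord \<Rightarrow> cord \<Rightarrow> cord"
  where "x + y = ord_rec x succ y"

definition times_cord :: "cord \<Rightarrow> cord \<Rightarrow> cord"
  where "x * y = ord_rec 0 (\<lambda>u. u + x) y"

instance ..

end

text \<open>For base zero this convention gives value one at limit exponents.\<close>

definition oexp :: "cord \<Rightarrow> cord \<Rightarrow> cord"  (infixr \<open>^\<^sub>o\<close> 80)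
  where "x ^\<^sub>o y = ord_rec 1 (\<lambda>u. u * x) y"

lemma plus_cord_rec:
  fixes x y :: cord
  shows "x + 0 = x"
    and "x + succ y = succ (x + y)"
    and "is_limit y \<Longrightarrow> x + y = lub ((\<lambda>v. x + v) ` {..<y})"
  by (simp_all add: plus_cord_def ord_rec_0 ord_rec_succ ord_rec_limit)

lemma times_cord_rec:
  fixes x y :: cord
  shows "x * 0 = 0"
    and "x * succ y = x * y + x"
    and "is_limit y \<Longrightarrow> x * y = lub ((\<lambda>v. x * v) ` {..<y})"
  by (simp_all add: times_cord_def ord_rec_0 ord_rec_succ ord_rec_limit)

lemma oexp_rec:
  shows "x ^\<^sub>o 0 = 1"
    and "x ^\<^sub>o succ y = x ^\<^sub>o y * x"
    and "is_limit y \<Longrightarrow> x ^\<^sub>o y = lub ((\<lambda>v. x ^\<^sub>o v) ` {..<y})"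
  by (simp_all add: oexp_def ord_rec_0 ord_rec_succ ord_rec_limit)

section \<open>Order topology\<close>

instantiation cord :: linorder_topology
begin

definition open_cord :: "cord set \<Rightarrow> bool"
  where "open_cord = generate_topology (range (\<lambda>a. {..<a}) \<union> range (\<lambda>a. {a<..}))"

instance
  by standard (rule open_cord_def)

end

text \<open>The order topology of the ordinal \<open>\<delta>\<close> is the subspace topology of \<open>{..<\<delta>}\<close>.\<close>

lemma order_topology_lessThan:
  fixes \<delta> :: cord
  shows "top_of_set {..<\<delta>} = topology_generated_by
    (insert {..<\<delta>} ((\<lambda>a. {..<a}) ` {..<\<delta>} \<union> (\<lambda>a. {a<..<\<delta>}) ` {..<\<delta>}))"
    (is "_ = topology_generated_by ?S")
proof -
  have gen: "generate_topology_on ?S (V \<inter> {..<\<delta>})" if "open V" for V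
    using that unfolding open_cord_def
  proof (induction V rule: generate_topology.induct)
    case UNIV
    show ?case by (simp add: generate_topology_on.Basis)
  next
    case (Int a b)
    have "generate_topology_on ?S ((a \<inter> {..<\<delta>}) \<inter> (b \<inter> {..<\<delta>}))"
      by (rule generate_topology_on.Int[OF Int.IH])
    moreover have "(a \<inter> {..<\<delta>}) \<inter> (b \<inter> {..<\<delta>}) = a \<inter> b \<inter> {..<\<delta>}"
      by blast
    ultimately show ?case by simp
  next
    case (UN K)
    have "generate_topology_on ?S (\<Union>((\<lambda>k. k \<inter> {..<\<delta>}) ` K))"
    proof (rule generate_topology_on.UN)
      fix k assume "k \<in> (\<lambda>k. k \<inter> {..<\<delta>}) ` K"
      then show "generate_topology_on ?S k"
        using UN.IH by blast
    qed
    moreover have "\<Union>((\<lambda>k. k \<inter> {..<\<delta>}) ` K) = \<Union>K \<inter> {..<\<delta>}"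
      by blast
    ultimately show ?case by metis
  next
    case (Basis s)
    then consider a where "s = {..<a}" | a where "s = {a<..}"
      by blast
    then show ?case
    proof cases
      case (1 a)
      have "s \<inter> {..<\<delta>} = (if a < \<delta> then {..<a} else {..<\<delta>})"
        using 1 by auto
      then have "s \<inter> {..<\<delta>} \<in> ?S"
        by simp
      then show ?thesis by (rule generate_topology_on.Basis)
    next
      case (2 a)
      have eq: "s \<inter> {..<\<delta>} = {a<..<\<delta>}"
        using 2 by auto
      show ?thesis
      proof (cases "a < \<delta>")
        case True
        then show ?thesis unfolding eq by (simp add: generate_topology_on.Basis)
      next
        case False
        then have "{a<..<\<delta>} = {}" by auto
        then show ?thesis unfolding eq by (simp add: generate_topology_on.Empty)
      qed
    qed
  qed
  have "openin (top_of_set {..<\<delta>}) U \<longleftrightarrow> generate_topology_on ?S U" for U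
  proof
    assume "openin (top_of_set {..<\<delta>}) U"
    then obtain V where "open V" "U = {..<\<delta>} \<inter> V"
      unfolding openin_open by blast
    then show "generate_topology_on ?S U"
      using gen[of V] by (metis Int_commute)
  next
    assume "generate_topology_on ?S U"
    then show "openin (top_of_set {..<\<delta>}) U"
    proof (induction U rule: generate_topology_on.induct)
      case (Basis s)
      then have "open s" "s \<subseteq> {..<\<delta>}"
        by auto
      then show ?case by (simp add: open_subset)
    next
      case Empty
      show ?case by (rule openin_empty)
    next
      case (Int a b)
      show ?case by (rule openin_Int[OF Int.IH])
    next
      case (UN K)
      then show ?case by (metis openin_Union)
    qed
  qed
  then show ?thesis
    by (simp add: topology_eq openin_topology_generated_by_iff)
qed

section \<open>The topological partition relation\<close>

datatype colour = Red | Blue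

text \<open>A colouring is a function on all sets; only its values on \<open>[{..<\<delta>}]\<^bsup>2\<^esup>\<close> matter.
  By \<open>order_topology_lessThan\<close>, the subspace topologies that \<open>X\<close> inherits from the ordinal
  \<open>\<delta>\<close> and from \<^typ>\<open>cord\<close> coincide.\<close>

definition top_arrow :: "cord \<Rightarrow> cord \<Rightarrow> nat \<Rightarrow> bool"
  where "top_arrow \<delta> \<mu> k \<longleftrightarrow>
    (\<forall>c :: cord set \<Rightarrow> colour.
      (\<exists>X. X \<subseteq> {..<\<delta>} \<and> X homeomorphic {..<\<mu>} \<and> (\<forall>e\<in>[X]\<^bsup>2\<^esup>. c e = Red)) \<or>
      (\<exists>Y\<in>[{..<\<delta>}]\<^bsup>k\<^esup>. \<forall>e\<in>[Y]\<^bsup>2\<^esup>. c e = Blue))"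

end

theory Submission
  imports Defs
begin

text \<open>
  Write \<open>t = \<omega>^(\<omega>^\<alpha> * \<beta>)\<close> and let \<open>N x\<close> be the set of points of \<open>t\<close> joined to \<open>x\<close> by a blue
  pair.  If some \<open>N x\<close> contains a homeomorphic copy of \<open>\<omega>^(\<omega>^\<alpha>)\<close>, the hypothesis applies inside
  that copy: it yields a red copy of \<open>\<omega>^\<beta>\<close>, or a blue set with \<open>k\<close> elements, to which \<open>x\<close>
  can be added.

  Otherwise every \<open>N x\<close> is small, and a red copy of \<open>\<omega>^\<beta>\<close> is built point by point.  Sizes are
  measured by iterated limit points: \<open>p\<close> lies in \<open>derived A c\<close> if, for every \<open>d < c\<close>, it is a
  limit of points of \<open>A\<close> that lie in \<open>derived A d\<close>.  A set \<open>A\<close> with \<open>derived A c\<close> nonempty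
  contains a copy of \<open>\<omega>^c\<close> when \<open>c \<noteq> 0\<close> (\<open>copy_in_derived\<close>), so \<open>derived (N x) (\<omega>^\<alpha>)\<close> is empty
  for all \<open>x\<close>.  The order of a limit point of a union of two sets is controlled by its
  orders in the two parts through the natural (Hessenberg) sum
  (\<open>derived_Un_nsum\<close>).  Ordinals below \<open>\<omega>^\<alpha>\<close> are absorbed by multiples of \<open>\<omega>^\<alpha>\<close> under the natural
  sum, so deleting finitely many of the sets \<open>N x\<close> leaves every limit point of order
  \<open>\<omega>^\<alpha> * c\<close> with at least that order (\<open>derived_Diff_finite\<close>).

  Now \<open>t\<close> has order \<open>\<omega>^\<alpha> * \<beta>\<close> in the set of smaller ordinals.  Choose a sequence of points, each
  with a target order \<open>c\<close> and with true order at least \<open>\<omega>^\<alpha> * c\<close>, where a new point is always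
  taken outside the blue neighbourhoods of the finitely many earlier ones and close below \<open>t\<close> or below an
  earlier point of larger target order.  By the absorption fact such a choice is always possible, and by
  bookkeeping over countably many requirements every target order is reached
  (\<open>generic_independent_set\<close>).  The chosen points form a red set in which \<open>t\<close> is a limit point of
  order \<open>\<beta>\<close>, hence a red set containing a copy of \<open>\<omega>^\<beta>\<close>.
\<close>

section \<open>Ordinal arithmetic\<close>

lemma cord_cases: obtains "x = 0" | y where "x = succ y" | "is_limit x"
  unfolding is_limit_def by blast

lemma limit_succ_less: "is_limit x \<Longrightarrow> y < x \<Longrightarrow> succ y < x"
  by (metis is_limit_def succ_le_iff order_le_less)

lemma lub_upper: "countable A \<Longrightarrow> a \<in> A \<Longrightarrow> a \<le> lub A"
  using lub_le_iff[of A "lub A"] by blast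

lemma less_lub_iff: "countable A \<Longrightarrow> b < lub A \<longleftrightarrow> (\<exists>a\<in>A. b < a)"
  using lub_le_iff[of A b] by (auto simp: linorder_not_le[symmetric])

text \<open>
  In this form a value defined as a supremum at a limit argument can be compared with any bound
  without mentioning \<^const>\<open>lub\<close>; it is instantiated for all three arithmetic operations.
\<close>

lemma limit_rec_upper:
  fixes h :: "cord \<Rightarrow> cord"
  assumes "h l = lub (h ` {..<l})"
  shows "y < l \<Longrightarrow> h y \<le> h l"
    and "b < h l \<longleftrightarrow> (\<exists>v<l. b < h v)"
    and "h l \<le> b \<longleftrightarrow> (\<forall>v<l. h v \<le> b)"
proof -
  have c: "countable (h ` {..<l})" by (intro countable_image countable_lessThan_cord)
  show "y < l \<Longrightarrow> h y \<le> h l" using lub_upper[OF c] assms by auto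
  show "b < h l \<longleftrightarrow> (\<exists>v<l. b < h v)" using less_lub_iff[OF c] assms by auto
  show "h l \<le> b \<longleftrightarrow> (\<forall>v<l. h v \<le> b)" using lub_le_iff[OF c] assms by auto
qed

lemmas add_limit = limit_rec_upper[OF plus_cord_rec(3)]
lemmas mult_limit = limit_rec_upper[OF times_cord_rec(3)]
lemmas oexp_limit = limit_rec_upper[OF oexp_rec(3)]

lemma cord_not_less_zero [simp]: "\<not> x < (0::cord)" by (simp add: linorder_not_less)

lemma cord_zero_less_iff: "0 < (x::cord) \<longleftrightarrow> x \<noteq> 0"
  by (metis cord_not_less_zero linorder_neqE)

lemma normal_strict_mono:
  fixes h :: "cord \<Rightarrow> cord"
  assumes s: "\<And>y. h y < h (succ y)" and l: "\<And>l. is_limit l \<Longrightarrow> h l = lub (h ` {..<l})"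
  assumes "y < z" shows "h y < h z"
  using \<open>y < z\<close>
proof (induction z rule: less_induct)
  case (less z)
  show ?case
  proof (cases z rule: cord_cases)
    case 1 then show ?thesis using less.prems by simp
  next
    case (2 v)
    then have "y \<le> v" using less.prems by (simp add: less_succ_iff)
    then show ?thesis using less.IH[of v] s[of v] 2 less_succ[of v] by (auto simp: order_le_less)
  next
    case 3
    then have sy: "succ y < z" using less.prems limit_succ_less by blast
    show ?thesis using s[of y] limit_rec_upper(1)[OF l[OF 3] sy] by simp
  qed
qed

lemma add_strict_mono: fixes x :: cord shows "y < z \<Longrightarrow> x + y < x + z"
  by (rule normal_strict_mono[of "(+) x"]) (simp_all add: plus_cord_rec less_succ)

lemma add_less_cancel: fixes x :: cord shows "x + y < x + z \<longleftrightarrow> y < z"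
  by (metis add_strict_mono linorder_neqE order_less_asym order_less_irrefl)

lemma add_le_cancel: fixes x :: cord shows "x + y \<le> x + z \<longleftrightarrow> y \<le> z"
  by (metis add_less_cancel linorder_not_less)

lemma le_add_left: fixes x :: cord shows "x \<le> x + y"
  using add_le_cancel[of x 0 y] by (simp add: plus_cord_rec(1,2))

lemma add_is_limit: fixes x :: cord
  assumes "is_limit y" shows "is_limit (x + y)"
proof -
  have "x + y \<noteq> succ v" for v
  proof
    assume e: "x + y = succ v"
    then obtain u where "u < y" "v < x + u"
      using add_limit(2)[OF assms, of v x] less_succ[of v] by auto
    then have "succ v < x + y"
      using add_strict_mono[of u y x] by (meson le_less_trans succ_le_iff)
    then show False using e by simp
  qed
  moreover have "0 < y" using assms by (auto simp: is_limit_def cord_zero_less_iff)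
  then have "0 < x + y" using add_strict_mono[of 0 y x] by (metis cord_zero_less_iff cord_not_less_zero)
  ultimately show ?thesis by (auto simp: is_limit_def)
qed

lemma add_assoc_cord: fixes x :: cord shows "(x + y) + z = x + (y + z)"
proof (induction z rule: less_induct)
  case (less z)
  show ?case
  proof (cases z rule: cord_cases)
    case 1 then show ?thesis by (simp add: plus_cord_rec(1,2))
  next
    case (2 v) then show ?thesis using less.IH[of v] by (simp add: plus_cord_rec less_succ)
  next
    case 3
    show ?thesis
    proof (rule order_antisym)
      show "(x + y) + z \<le> x + (y + z)"
        unfolding add_limit(3)[OF 3] using less.IH by (auto simp: add_le_cancel intro: less_imp_le)
      show "x + (y + z) \<le> (x + y) + z"
        unfolding add_limit(3)[OF add_is_limit[OF 3]]
      proof (intro allI impI)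
        fix v assume "v < y + z"
        then obtain u where u: "u < z" "v < y + u" using add_limit(2)[OF 3] by blast
        then have "x + v \<le> x + (y + u)" by (simp add: add_le_cancel less_imp_le)
        also have "\<dots> \<le> (x + y) + z" using less.IH[OF u(1)] u(1) by (metis add_le_cancel less_imp_le)
        finally show "x + v \<le> (x + y) + z" .
      qed
    qed
  qed
qed

lemma add_right_mono_cord: fixes x :: cord
  assumes "x \<le> y" shows "x + z \<le> y + z"
proof (induction z rule: less_induct)
  case (less z)
  show ?case
  proof (cases z rule: cord_cases)
    case 1 then show ?thesis using assms by (simp add: plus_cord_rec(1,2))
  next
    case (2 v) then show ?thesis
      using less.IH[of v] by (simp add: plus_cord_rec less_succ succ_le_iff less_succ_iff)
  next
    case 3 then show ?thesis
      unfolding add_limit(3)[OF 3] using less.IH add_limit(1)[OF 3, of _ y] by (meson order_trans)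
  qed
qed

text \<open>
  The difference is the least \<open>z\<close> with \<open>y \<le> x + z\<close>: continuity of \<open>z \<mapsto> x + z\<close> rules out
  overshooting.
\<close>

lemma ex_diff_cord: fixes x :: cord
  assumes "x \<le> y" shows "\<exists>z. y = x + z"
proof -
  have "y \<le> 0 + y" for y :: cord
  proof (induction y rule: less_induct)
    case (less y)
    then show ?case by (metis add_strict_mono le_less_trans linorder_not_le order_less_irrefl)
  qed
  then have "y \<le> x + y" using add_right_mono_cord[of 0 x y] by (meson order_trans zero_le_cord)
  then have ex: "\<exists>z. y \<le> x + z" by blast
  define z where "z = (LEAST z. y \<le> x + z)"
  have z: "y \<le> x + z" unfolding z_def using ex by (rule LeastI_ex)
  have m: "v < z \<Longrightarrow> x + v < y" for v
    unfolding z_def using not_less_Least[of v "\<lambda>z. y \<le> x + z"] by (simp add: linorder_not_le)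
  have "x + z \<le> y"
  proof (cases z rule: cord_cases)
    case 1 then show ?thesis using assms by (simp add: plus_cord_rec(1,2))
  next
    case (2 v) then show ?thesis using m[of v] by (simp add: plus_cord_rec less_succ succ_le_iff)
  next
    case 3 then show ?thesis unfolding add_limit(3)[OF 3] using m less_imp_le by blast
  qed
  then show ?thesis using z by (metis order_antisym)
qed

lemma add_0_left_cord: "0 + (y::cord) = y"
proof (induction y rule: less_induct)
  case (less y)
  show ?case
  proof (cases y rule: cord_cases)
    case 3
    then have "0 + y \<le> b \<longleftrightarrow> y \<le> b" for b
      unfolding add_limit(3)[OF 3] using less.IH limit_succ_less[OF 3]
      by (auto intro: less_imp_le order_trans simp: linorder_not_less[symmetric]) (meson less_imp_le less_succ linorder_not_less)
    then show ?thesis by (metis order_antisym order_refl)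
  qed (use less.IH in \<open>auto simp: plus_cord_rec less_succ\<close>)
qed

lemma mult_strict_mono_cord: fixes x :: cord
  assumes "x \<noteq> 0" "y < z" shows "x * y < x * z"
proof (rule normal_strict_mono[of "(*) x"])
  show "x * y < x * succ y" for y
    using add_strict_mono[of 0 x "x * y"] assms(1) by (simp add: times_cord_rec plus_cord_rec(1,2) cord_zero_less_iff)
qed (simp_all add: times_cord_rec assms)

lemma mult_mono_cord: fixes x :: cord
  assumes "y \<le> z" shows "x * y \<le> x * z"
proof (cases "x = 0")
  case True
  have "0 * y = (0::cord)" for y :: cord
  proof (induction y rule: less_induct)
    case (less y)
    show ?case
    proof (cases y rule: cord_cases)
      case 3
      then show ?thesis using mult_limit(3)[OF 3, of 0 0] less.IH by (metis order_antisym order_refl zero_le_cord)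
    qed (use less.IH in \<open>auto simp: times_cord_rec plus_cord_rec less_succ\<close>)
  qed
  then show ?thesis using True by simp
qed (use assms mult_strict_mono_cord in \<open>auto simp: order_le_less\<close>)

text \<open>
  The least \<open>z\<close> with \<open>x < u * z\<close> cannot be zero or a limit; its predecessor is the quotient.
\<close>

lemma division_cord: fixes u :: cord
  assumes "x < u * y" obtains q r where "q < y" "r < u" "x = u * q + r"
proof -
  define z where "z = (LEAST z. x < u * z)"
  have z: "x < u * z" unfolding z_def using assms by (rule LeastI)
  have zy: "z \<le> y" unfolding z_def using assms by (rule Least_le)
  have m: "v < z \<Longrightarrow> u * v \<le> x" for v
    unfolding z_def using not_less_Least[of v "\<lambda>z. x < u * z"] by (simp add: linorder_not_less)
  show thesis
  proof (cases z rule: cord_cases)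
    case 1 then show ?thesis using z by (simp add: times_cord_rec)
  next
    case (2 q)
    obtain r where r: "x = u * q + r" using ex_diff_cord[OF m[of q]] 2 less_succ by blast
    have "r < u" using z r 2 by (simp add: times_cord_rec add_less_cancel)
    moreover have "q < y" using 2 zy succ_le_iff by blast
    ultimately show ?thesis using r that by blast
  next
    case 3 then show ?thesis using mult_limit(2)[OF 3] z m by (metis linorder_not_less)
  qed
qed

text \<open>
  The representing relation of \<^const>\<open>\<omega>\<close> is the order of the natural numbers, and an order isomorphism
  onto an initial segment must send \<open>n\<close> to the \<open>n\<close>-th successor of zero.
\<close>

lemma less_omega_iff: "x < \<omega> \<longleftrightarrow> (\<exists>n. x = (succ ^^ n) 0)"
proof -
  have "(natLeq, seg \<omega>) \<in> ordIso"
    using ordIso_seg_abs[OF natLeq_Well_order] by (simp add: \<omega>_def)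
  then obtain f where "iso natLeq (seg \<omega>) f" by (auto simp: ordIso_def)
  then have bij: "bij_betw f UNIV {..<\<omega>}" and le: "\<And>i j. i \<le> j \<longleftrightarrow> f i \<le> f j \<and> f j < \<omega>"
    unfolding iso_iff2 Field_natLeq Field_seg by (simp_all add: seg_def natLeq_def)
  have lw: "f n < \<omega>" for n using bij by (auto simp: bij_betw_def)
  have onto: "y < \<omega> \<Longrightarrow> \<exists>n. y = f n" for y using bij by (auto simp: bij_betw_def)
  have le': "i \<le> j \<longleftrightarrow> f i \<le> f j" for i j using le lw by blast
  have lt: "i < j \<longleftrightarrow> f i < f j" for i j using le'[of j i] by (simp add: linorder_not_le[symmetric])
  have "f n = (succ ^^ n) 0" for n
  proof (induction n)
    case 0
    have "(0::cord) < \<omega>" using lw[of 0] by (metis le_less_trans zero_le_cord)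
    then obtain m where "0 = f m" using onto by blast
    then show ?case using le'[of 0 m] by (simp add: order_antisym)
  next
    case (Suc n)
    have a: "succ (f n) \<le> f (Suc n)" using lt[of n "Suc n"] by (simp add: succ_le_iff)
    then obtain m where m: "succ (f n) = f m" using onto lw le_less_trans by blast
    then have "n < m" using lt[of n m] less_succ by metis
    then have "f (Suc n) \<le> succ (f n)" using le'[of "Suc n" m] m by simp
    then show ?case using a Suc.IH by simp
  qed
  then show ?thesis using lw onto by metis
qed

lemma is_limit_omega: "is_limit \<omega>"
proof -
  have "(0::cord) < \<omega>" using less_omega_iff[of 0] by (metis funpow_0)
  moreover have "y < \<omega> \<Longrightarrow> succ y < \<omega>" for y
    unfolding less_omega_iff using funpow.simps(2)[of _ succ] by (auto simp del: funpow.simps) (metis comp_apply)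
  ultimately show ?thesis unfolding is_limit_def using less_succ by (metis order_less_irrefl)
qed

lemma oexp_omega_pos: "\<omega> ^\<^sub>o x \<noteq> 0"
proof (induction x rule: less_induct)
  case (less x)
  show ?case
  proof (cases x rule: cord_cases)
    case 1 then show ?thesis by (simp add: oexp_rec one_cord_def)
  next
    case (2 y)
    then have "\<omega> ^\<^sub>o y * 0 < \<omega> ^\<^sub>o y * \<omega>"
      using less.IH[of y] is_limit_omega by (intro mult_strict_mono_cord) (auto simp: less_succ is_limit_def cord_zero_less_iff)
    then show ?thesis using 2 by (auto simp: oexp_rec)
  next
    case 3
    then have "0 < x" by (auto simp: is_limit_def cord_zero_less_iff)
    then show ?thesis using oexp_limit(2)[OF 3, of 0 \<omega>] less.IH[of 0]
      by (metis cord_not_less_zero cord_zero_less_iff)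
  qed
qed

lemma oexp_omega_strict_mono: "x < y \<Longrightarrow> \<omega> ^\<^sub>o x < \<omega> ^\<^sub>o y"
proof (rule normal_strict_mono[of "\<lambda>x. \<omega> ^\<^sub>o x"])
  show "\<omega> ^\<^sub>o y < \<omega> ^\<^sub>o succ y" for y
  proof -
    have "succ 0 < \<omega>" using limit_succ_less[OF is_limit_omega] is_limit_omega by (auto simp: is_limit_def cord_zero_less_iff)
    moreover have "\<omega> ^\<^sub>o y * succ 0 = \<omega> ^\<^sub>o y" 
      by (simp add: times_cord_rec add_0_left_cord)
    ultimately show ?thesis using mult_strict_mono_cord[OF oexp_omega_pos, of "succ 0" \<omega> y] by (simp add: oexp_rec)
  qed
qed (simp_all add: oexp_rec)

lemma oexp_omega_mono: "x \<le> y \<Longrightarrow> \<omega> ^\<^sub>o x \<le> \<omega> ^\<^sub>o y"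
  using oexp_omega_strict_mono by (auto simp: order_le_less)

lemma funpow_add_eq: "((\<lambda>v. v + u) ^^ n) a = a + u * (succ ^^ n) (0::cord)"
  by (induction n) (simp_all add: times_cord_rec plus_cord_rec add_assoc_cord)

text \<open>
  The ordinal \<open>a + \<omega>^\<gamma>\<close> is approached from \<open>a\<close> by finitely many steps of one length \<open>\<omega>^d\<close> with
  \<open>d < \<gamma>\<close>: a successor \<open>\<gamma>\<close> needs many steps of the largest length, a limit \<open>\<gamma>\<close> a single step.
\<close>

lemma less_add_oexp:
  assumes "y < a + \<omega> ^\<^sub>o \<gamma>" "\<gamma> \<noteq> 0"
  obtains d n where "d < \<gamma>" "y < ((\<lambda>v. v + \<omega> ^\<^sub>o d) ^^ n) a"
proof (cases "y < a")
  case True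
  then show ?thesis using that[of 0 0] assms by (simp add: cord_zero_less_iff)
next
  case False
  then obtain z where z: "y = a + z" using ex_diff_cord[of a y] by (auto simp: linorder_not_less)
  then have zl: "z < \<omega> ^\<^sub>o \<gamma>" using assms by (simp add: add_less_cancel)
  show ?thesis
  proof (cases \<gamma> rule: cord_cases)
    case 1 then show ?thesis using assms by simp
  next
    case (2 d)
    then obtain v where "v < \<omega>" "z < \<omega> ^\<^sub>o d * v"
      using zl mult_limit(2)[OF is_limit_omega] by (auto simp: oexp_rec)
    then obtain n where "z < \<omega> ^\<^sub>o d * (succ ^^ n) 0" unfolding less_omega_iff by blast
    then show ?thesis using that[of d n] 2 z by (simp add: funpow_add_eq add_less_cancel less_succ)
  next
    case 3
    then obtain v where "v < \<gamma>" "z < \<omega> ^\<^sub>o v" using zl oexp_limit(2) by blast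
    then show ?thesis using that[of v 1] z by (simp add: add_less_cancel)
  qed
qed

text \<open>
  Additive indecomposability of \<open>\<omega>^\<gamma>\<close>, relative to a starting point \<open>a\<close>.
\<close>

lemma add_oexp_less:
  assumes "y < a + \<omega> ^\<^sub>o \<gamma>" "d < \<gamma>" shows "y + \<omega> ^\<^sub>o d < a + \<omega> ^\<^sub>o \<gamma>"
proof -
  have "\<gamma> \<noteq> 0" using assms by auto
  then obtain d' n where d': "d' < \<gamma>" and y: "y < ((\<lambda>v. v + \<omega> ^\<^sub>o d') ^^ n) a"
    using less_add_oexp[OF assms(1)] by blast
  define e where "e = max d d'"
  let ?k = "(succ ^^ n) 0"
  have e: "e < \<gamma>" using assms d' by (simp add: e_def)
  have mono: "((\<lambda>v. v + \<omega> ^\<^sub>o d') ^^ n) a \<le> ((\<lambda>v. v + \<omega> ^\<^sub>o e) ^^ n) a"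
  proof (induction n)
    case (Suc n)
    have "\<omega> ^\<^sub>o d' \<le> \<omega> ^\<^sub>o e" by (simp add: e_def oexp_omega_mono)
    then have "((\<lambda>v. v + \<omega> ^\<^sub>o e) ^^ n) a + \<omega> ^\<^sub>o d' \<le> ((\<lambda>v. v + \<omega> ^\<^sub>o e) ^^ n) a + \<omega> ^\<^sub>o e"
      by (simp only: add_le_cancel)
    with add_right_mono_cord[OF Suc, of "\<omega> ^\<^sub>o d'"] show ?case
      unfolding funpow.simps comp_apply by (rule order_trans)
  qed simp
  have "y + \<omega> ^\<^sub>o d \<le> (a + \<omega> ^\<^sub>o e * ?k) + \<omega> ^\<^sub>o e"
  proof (rule order_trans[OF add_right_mono_cord])
    show "y \<le> a + \<omega> ^\<^sub>o e * ?k" using less_le_trans[OF y mono] unfolding funpow_add_eq by (rule less_imp_le)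
    show "(a + \<omega> ^\<^sub>o e * ?k) + \<omega> ^\<^sub>o d \<le> (a + \<omega> ^\<^sub>o e * ?k) + \<omega> ^\<^sub>o e"
      unfolding add_le_cancel by (rule oexp_omega_mono) (simp add: e_def)
  qed
  also have "\<dots> = a + \<omega> ^\<^sub>o e * succ ?k" by (simp add: add_assoc_cord times_cord_rec)
  also have "\<dots> < a + \<omega> ^\<^sub>o e * \<omega>"
    using less_omega_iff[of "succ ?k"] 
    by (intro add_strict_mono mult_strict_mono_cord oexp_omega_pos) (metis comp_apply funpow.simps(2))
  also have "\<dots> \<le> a + \<omega> ^\<^sub>o \<gamma>" 
    using oexp_omega_mono[of "succ e" \<gamma>] e by (simp add: add_le_cancel oexp_rec succ_le_iff)
  finally show ?thesis .
qed

section \<open>The natural sum\<close>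

text \<open>
  This is the natural (Hessenberg) sum, in its recursive characterisation as the least function that
  is strictly increasing in each argument.  Strict monotonicity is what the topological argument uses.
\<close>

function nsum :: "cord \<Rightarrow> cord \<Rightarrow> cord" where
  "nsum x y = lub ((\<lambda>u. succ (nsum u y)) ` {..<x} \<union> (\<lambda>v. succ (nsum x v)) ` {..<y})"
  by auto
termination
  by (relation "{(x, y). x < y} <*lex*> {(x, y). x < y}") (auto intro!: wf_lex_prod simp: wf)

declare nsum.simps [simp del]

lemma nsum_le_iff: "nsum x y \<le> z \<longleftrightarrow> (\<forall>u<x. nsum u y < z) \<and> (\<forall>v<y. nsum x v < z)"
proof -
  have "countable ((\<lambda>u. succ (nsum u y)) ` {..<x} \<union> (\<lambda>v. succ (nsum x v)) ` {..<y})"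
    by (intro countable_Un countable_image countable_lessThan_cord)
  from lub_le_iff[OF this, of z] show ?thesis
    unfolding nsum.simps[of x y, symmetric] by (simp add: succ_le_iff ball_Un lessThan_def)
qed

lemma nsum_less: "u < x \<Longrightarrow> nsum u y < nsum x y" "v < y \<Longrightarrow> nsum x v < nsum x y"
  using nsum_le_iff[of x y "nsum x y"] by auto

lemma funpow_succ_less: "x < y \<Longrightarrow> (succ ^^ m) x < (succ ^^ m) y"
  by (induction m) (simp_all add: less_succ_iff succ_le_iff)

lemma funpow_succ_le: "m \<le> n \<Longrightarrow> (succ ^^ m) x \<le> (succ ^^ n) x"
  by (induction n rule: dec_induct) (auto intro: order_trans less_imp_le[OF less_succ])

lemma le_funpow_succ_0: "x \<le> (succ ^^ m) 0 \<Longrightarrow> \<exists>n\<le>m. x = (succ ^^ n) 0"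
proof (induction m)
  case 0
  then show ?case using zero_le_cord[of x] by (auto intro: order_antisym)
next
  case (Suc m)
  show ?case
  proof (cases "x \<le> (succ ^^ m) 0")
    case True
    then show ?thesis using Suc.IH le_SucI by blast
  next
    case False
    then have "x = (succ ^^ Suc m) 0" using Suc.prems
      by (simp add: linorder_not_le) (metis less_succ_iff linorder_not_le order_antisym succ_le_iff)
    then show ?thesis by blast
  qed
qed

text \<open>
  If \<open>u\<close> is closed under natural sums, then multiples of \<open>u\<close> and remainders below \<open>u\<close> are added
  separately, at least as an upper bound.  Lowering an argument either lowers its remainder, which is
  covered by the term \<open>nsum r s\<close>, or lowers its quotient, which makes room for a whole block \<open>u\<close>.
  The second quotient is finite because \<open>(q + 1) + m\<close> and \<open>(q + m) + 1\<close> coincide only for finite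
  \<open>m\<close>.
\<close>

lemma nsum_block:
  assumes cl: "\<And>r s. r < u \<Longrightarrow> s < u \<Longrightarrow> nsum r s < u"
    and "r < u" "s < u"
  shows "nsum (u * q + r) (u * (succ ^^ m) 0 + s) \<le> u * (succ ^^ m) q + nsum r s"
proof -
  have step: "u * v + nsum r s < u * succ v" if "r < u" "s < u" for v r s
    using cl[OF that] by (simp add: times_cord_rec add_strict_mono)
  have "nsum x y \<le> u * (succ ^^ m) q + nsum r s"
    if "x = u * q + r" "r < u" "y = u * (succ ^^ m) 0 + s" "s < u" for x y q r m s
    using that
  proof (induction x y arbitrary: q r m s rule: nsum.induct)
    case (1 x y)
    show ?case
      unfolding nsum_le_iff[of x y]
    proof (intro conjI allI impI)
      fix x' assume x': "x' < x"
      also have "x < u * succ q" using "1.prems" by (simp add: times_cord_rec add_strict_mono)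
      finally obtain q' r' where q': "q' < succ q" "r' < u" "x' = u * q' + r'"
        by (rule division_cord)
      have IH: "nsum x' y \<le> u * (succ ^^ m) q' + nsum r' s"
        using "1.IH"(1)[OF _ q'(3,2) "1.prems"(3,4)] x' by simp
      show "nsum x' y < u * (succ ^^ m) q + nsum r s"
      proof (cases "q' = q")
        case True
        then have "r' < r" using x' q' "1.prems" by (simp add: add_less_cancel)
        then show ?thesis using IH True nsum_less(1)[of r' r s] add_strict_mono le_less_trans by blast
      next
        case False
        then have "q' < q" using q'(1) by (simp add: less_succ_iff)
        then have "u * succ ((succ ^^ m) q') \<le> u * (succ ^^ m) q"
          by (intro mult_mono_cord) (simp add: succ_le_iff funpow_succ_less)
        also have "\<dots> \<le> u * (succ ^^ m) q + nsum r s" by (rule le_add_left)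
        finally show ?thesis
          using le_less_trans[OF IH step[OF q'(2) "1.prems"(4)]] by (meson less_le_trans)
      qed
    next
      fix y' assume y': "y' < y"
      also have "y < u * succ ((succ ^^ m) 0)" using "1.prems" by (simp add: times_cord_rec add_strict_mono)
      finally obtain q' s' where q': "q' < succ ((succ ^^ m) 0)" "s' < u" "y' = u * q' + s'"
        by (rule division_cord)
      then obtain n where n: "n \<le> m" "q' = (succ ^^ n) 0"
        using le_funpow_succ_0 by (auto simp: less_succ_iff)
      have IH: "nsum x y' \<le> u * (succ ^^ n) q + nsum r s'"
        using "1.IH"(2)[OF _ "1.prems"(1,2) _ q'(2), of y' n] q'(3) n(2) y' by simp
      show "nsum x y' < u * (succ ^^ m) q + nsum r s"
      proof (cases "n = m")
        case True
        then have "s' < s" using y' q' n "1.prems" by (simp add: add_less_cancel)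
        then show ?thesis using IH True nsum_less(2)[of s' s r] add_strict_mono le_less_trans by blast
      next
        case False
        then have "u * (succ ^^ Suc n) q \<le> u * (succ ^^ m) q"
          using n(1) by (intro mult_mono_cord funpow_succ_le) simp
        also have "\<dots> \<le> u * (succ ^^ m) q + nsum r s" by (rule le_add_left)
        finally show ?thesis
          using le_less_trans[OF IH step[OF "1.prems"(2) q'(2)]] by (simp add: less_le_trans)
      qed
    qed
  qed
  then show ?thesis using assms by blast
qed

text \<open>
  At a successor exponent both summands are finite multiples of a smaller power plus a remainder, and
  \<open>nsum_block\<close> bounds their natural sum by another finite multiple.
\<close>

lemma nsum_less_oexp: "r < \<omega> ^\<^sub>o a \<Longrightarrow> s < \<omega> ^\<^sub>o a \<Longrightarrow> nsum r s < \<omega> ^\<^sub>o a"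
proof (induction a arbitrary: r s rule: less_induct)
  case (less a)
  show ?case
  proof (cases a rule: cord_cases)
    case 1
    then have "r = 0" "s = 0" using less.prems
      by (auto simp: oexp_rec one_cord_def less_succ_iff intro: order_antisym)
    then show ?thesis using nsum_le_iff[of 0 0 0] 1
      by (simp add: oexp_rec one_cord_def less_succ_iff)
  next
    case (2 b)
    let ?u = "\<omega> ^\<^sub>o b"
    have cl: "nsum r s < ?u" if "r < ?u" "s < ?u" for r s
      using less.IH[of b] that 2 less_succ by blast
    obtain q r' where q: "q < \<omega>" "r' < ?u" "r = ?u * q + r'"
      using less.prems(1) 2 by (auto simp: oexp_rec elim: division_cord)
    obtain p s' where p: "p < \<omega>" "s' < ?u" "s = ?u * p + s'"
      using less.prems(2) 2 by (auto simp: oexp_rec elim: division_cord)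
    obtain n m where n: "q = (succ ^^ n) 0" and m: "p = (succ ^^ m) 0"
      using q(1) p(1) unfolding less_omega_iff by blast
    have "nsum r s \<le> ?u * (succ ^^ m) q + nsum r' s'"
      using nsum_block[OF cl q(2) p(2), of q m] q(3) p(3) m by simp
    also have "\<dots> < ?u * succ ((succ ^^ m) q)"
      using cl[OF q(2) p(2)] by (simp add: times_cord_rec add_strict_mono)
    also have "succ ((succ ^^ m) q) = (succ ^^ Suc (m + n)) 0"
      by (simp add: n funpow_add)
    also have "?u * \<dots> < ?u * \<omega>"
      by (intro mult_strict_mono_cord oexp_omega_pos) (unfold less_omega_iff, blast)
    finally show ?thesis using 2 by (simp add: oexp_rec)
  next
    case 3
    obtain v w where v: "v < a" "r < \<omega> ^\<^sub>o v" and w: "w < a" "s < \<omega> ^\<^sub>o w"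
      using less.prems oexp_limit(2)[OF 3] by blast
    have "nsum r s < \<omega> ^\<^sub>o max v w"
      using v w oexp_omega_mono[of v "max v w"] oexp_omega_mono[of w "max v w"]
      by (intro less.IH) auto
    also have "\<dots> < \<omega> ^\<^sub>o a" using v w by (intro oexp_omega_strict_mono) simp
    finally show ?thesis .
  qed
qed

text \<open>
  Multiples of \<open>\<omega>^a\<close> absorb ordinals below \<open>\<omega>^a\<close>: only the remainder modulo \<open>\<omega>^a\<close> is affected.
\<close>

lemma nsum_less_oexp_times:
  assumes "x < \<omega> ^\<^sub>o a * c" "y < \<omega> ^\<^sub>o a"
  shows "nsum x y < \<omega> ^\<^sub>o a * c"
proof -
  obtain q r where q: "q < c" "r < \<omega> ^\<^sub>o a" "x = \<omega> ^\<^sub>o a * q + r"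
    using assms(1) by (rule division_cord)
  have "nsum x y \<le> \<omega> ^\<^sub>o a * q + nsum r y"
    using nsum_block[OF nsum_less_oexp q(2) assms(2), of q 0] q(3)
    by (simp add: times_cord_rec add_0_left_cord)
  also have "\<dots> < \<omega> ^\<^sub>o a * succ q"
    using nsum_less_oexp[OF q(2) assms(2)] by (simp add: times_cord_rec add_strict_mono)
  also have "\<dots> \<le> \<omega> ^\<^sub>o a * c" using q(1) by (intro mult_mono_cord) (simp add: succ_le_iff)
  finally show ?thesis .
qed

section \<open>Iterated limit points\<close>

lemma islimpt_cord_iff:
  "p islimpt (S :: cord set) \<longleftrightarrow> p \<noteq> 0 \<and> (\<forall>b<p. \<exists>q\<in>S. b < q \<and> q < p)"
proof
  assume p: "p islimpt S"
  have nb: "\<exists>q\<in>S. q \<in> T \<and> q < p" if "open T" "p \<in> T" for T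
  proof -
    have "open (T \<inter> {..<succ p})" "p \<in> T \<inter> {..<succ p}"
      using that by (auto simp: less_succ intro: open_Int)
    then obtain q where "q \<in> S" "q \<in> T \<inter> {..<succ p}" "q \<noteq> p"
      using p by (meson islimptE)
    then show ?thesis by (auto simp: less_succ_iff order_le_less)
  qed
  have "p \<noteq> 0" using nb[of UNIV] by auto
  moreover have "\<exists>q\<in>S. b < q \<and> q < p" if "b < p" for b
    using nb[of "{b<..}"] that by auto
  ultimately show "p \<noteq> 0 \<and> (\<forall>b<p. \<exists>q\<in>S. b < q \<and> q < p)" by blast
next
  assume r: "p \<noteq> 0 \<and> (\<forall>b<p. \<exists>q\<in>S. b < q \<and> q < p)"
  show "p islimpt S"
  proof (rule islimptI)
    fix T assume T: "p \<in> T" "open T"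
    have "0 < p" using r by (simp add: cord_zero_less_iff)
    then obtain b where "b < p" "{b<..p} \<subseteq> T" using open_left[OF T(2,1)] by blast
    then show "\<exists>y\<in>S. y \<in> T \<and> y \<noteq> p" using r by fastforce
  qed
qed

text \<open>
  The set \<open>A \<inter> derived A c\<close> is the \<open>c\<close>-th Cantor--Bendixson derivative of \<open>A\<close>, but the points of
  \<open>derived A c\<close> need not belong to \<open>A\<close>: this makes it possible to speak of the order of
  \<open>\<delta>\<close> as a limit of a subset of \<open>{..<\<delta>}\<close>, and to compare orders in different parts of a
  partition at the same point.
\<close>

function derived :: "cord set \<Rightarrow> cord \<Rightarrow> cord set" where
  "derived A c = {p. \<forall>d<c. p islimpt (A \<inter> derived A d)}"
  by auto
termination
  by (relation "inv_image {(x, y). x < y} snd") (auto intro!: wf_inv_image simp: wf)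

declare derived.simps [simp del]

lemma in_derived_iff: "p \<in> derived A c \<longleftrightarrow> (\<forall>d<c. p islimpt (A \<inter> derived A d))"
  by (subst derived.simps) simp

lemma derived_antimono: "c \<le> d \<Longrightarrow> derived A d \<subseteq> derived A c"
  by (auto simp: in_derived_iff[of _ A c] in_derived_iff[of _ A d] intro: less_le_trans)

lemma derived_mono: "A \<subseteq> B \<Longrightarrow> derived A c \<subseteq> derived B c"
proof (induction c rule: less_induct)
  case (less c)
  then have "A \<inter> derived A d \<subseteq> B \<inter> derived B d" if "d < c" for d using that by blast
  then show ?case
    unfolding subset_iff[of "derived A c"] in_derived_iff[of _ _ c] using islimpt_subset by blast
qed

text \<open>
  Suppose both alternatives fail, witnessed by \<open>x' < x\<close> and \<open>y' < y\<close>.  Arbitrarily close to \<open>p\<close>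
  there are points \<open>q\<close> of the union whose order is at least both \<open>nsum x' y\<close> and \<open>nsum x y'\<close>.
  If such \<open>q\<close> accumulate at \<open>p\<close> within \<open>M\<close>, then by induction each has order \<open>x'\<close> in \<open>M\<close> or order
  \<open>y\<close> in \<open>N\<close>.
  The first kind does not accumulate at \<open>p\<close>; the second kind consists of limits of points of \<open>N\<close> of order
  \<open>y'\<close>, so that these would accumulate at \<open>p\<close> too.  The case of \<open>N\<close> is symmetric.
\<close>

lemma derived_Un_nsum:
  assumes "p \<in> derived (M \<union> N) (nsum x y)"
  shows "p \<in> derived M x \<or> p \<in> derived N y"
  using assms
proof (induction x y arbitrary: p rule: nsum.induct)
  case (1 x y)
  show ?case
  proof (rule ccontr)
    assume "\<not> ?thesis"
    then obtain x' y' where x': "x' < x" "\<not> p islimpt (M \<inter> derived M x')"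
      and y': "y' < y" "\<not> p islimpt (N \<inter> derived N y')"
      by (metis in_derived_iff)
    \<comment> \<open>a limit of limit points of \<open>B\<close> is a limit point of \<open>B\<close>\<close>
    have lim: "p islimpt B" if AC: "p islimpt (A \<inter> C)" and CB: "\<And>q. q \<in> C \<Longrightarrow> q islimpt B" for A B C :: "cord set"
      unfolding islimpt_cord_iff
    proof (intro conjI allI impI)
      show "p \<noteq> 0" using AC by (simp add: islimpt_cord_iff)
      fix b assume "b < p"
      then obtain q where q: "q \<in> C" "b < q" "q < p" using AC unfolding islimpt_cord_iff by blast
      then obtain r where "r \<in> B" "b < r" "r < q" using CB[OF q(1)] unfolding islimpt_cord_iff by blast
      then show "\<exists>r\<in>B. b < r \<and> r < p" using q by (meson less_trans)
    qed
    define z where "z = max (nsum x' y) (nsum x y')"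
    have "z < nsum x y" using x' y' by (simp add: z_def nsum_less)
    then have pz: "p islimpt ((M \<union> N) \<inter> derived (M \<union> N) z)"
      using "1.prems" by (simp add: in_derived_iff)
    have q: "q \<in> derived M x' \<or> q \<in> derived N y" "q \<in> derived M x \<or> q \<in> derived N y'"
      if "q \<in> derived (M \<union> N) z" for q
      using that "1.IH"(1)[of x' q] "1.IH"(2)[of y' q] x' y'
        derived_antimono[of "nsum x' y" z "M \<union> N"] derived_antimono[of "nsum x y'" z "M \<union> N"]
      by (auto simp: z_def)
    have dM: "q islimpt (M \<inter> derived M x')" if "q \<in> derived M x" for q
      using that x'(1) by (simp add: in_derived_iff)
    have dN: "q islimpt (N \<inter> derived N y')" if "q \<in> derived N y" for q
      using that y'(1) by (simp add: in_derived_iff)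
    have "p islimpt (M \<inter> derived (M \<union> N) z) \<or> p islimpt (N \<inter> derived (M \<union> N) z)"
      using pz by (simp add: Int_Un_distrib2 islimpt_Un)
    then show False
    proof
      assume "p islimpt (M \<inter> derived (M \<union> N) z)"
      then have "p islimpt ((M \<inter> derived M x') \<union> (M \<inter> derived N y))"
        by (rule islimpt_subset) (use q(1) in blast)
      then have "p islimpt (M \<inter> derived N y)" using x'(2) by (simp add: islimpt_Un)
      then show False using lim[of M "derived N y"] dN y'(2) by blast
    next
      assume "p islimpt (N \<inter> derived (M \<union> N) z)"
      then have "p islimpt ((N \<inter> derived N y') \<union> (N \<inter> derived M x))"
        by (rule islimpt_subset) (use q(2) in blast)
      then have "p islimpt (N \<inter> derived M x)" using y'(2) by (simp add: islimpt_Un)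
      then show False using lim[of N "derived M x"] dM x'(2) by blast
    qed
  qed
qed

lemma in_derived_limitI:
  assumes "\<And>x. x < l \<Longrightarrow> succ x < l" "\<And>x. x < l \<Longrightarrow> p \<in> derived A x"
  shows "p \<in> derived A l"
  using assms less_succ by (metis in_derived_iff)

lemma is_limit_oexp:
  assumes "a \<noteq> 0" shows "is_limit (\<omega> ^\<^sub>o a)"
proof -
  have "succ x < \<omega> ^\<^sub>o a" if "x < \<omega> ^\<^sub>o a" for x
  proof -
    have "x + \<omega> ^\<^sub>o 0 < 0 + \<omega> ^\<^sub>o a"
      using that assms by (intro add_oexp_less) (simp_all add: add_0_left_cord cord_zero_less_iff)
    then show ?thesis by (simp add: oexp_rec one_cord_def plus_cord_rec(1,2) add_0_left_cord)
  qed
  then show ?thesis unfolding is_limit_def using less_succ oexp_omega_pos by (metis order_less_irrefl)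
qed

lemma succ_less_oexp_times:
  assumes "a \<noteq> 0" "x < \<omega> ^\<^sub>o a * c" shows "succ x < \<omega> ^\<^sub>o a * c"
proof -
  obtain q r where q: "q < c" "r < \<omega> ^\<^sub>o a" "x = \<omega> ^\<^sub>o a * q + r"
    using assms(2) by (rule division_cord)
  have "succ x < \<omega> ^\<^sub>o a * q + \<omega> ^\<^sub>o a"
    using limit_succ_less[OF is_limit_oexp[OF assms(1)] q(2)] add_strict_mono
    unfolding q(3) plus_cord_rec(2)[symmetric] by blast
  also have "\<dots> = \<omega> ^\<^sub>o a * succ q" by (simp add: times_cord_rec)
  also have "\<dots> \<le> \<omega> ^\<^sub>o a * c" using q(1) by (intro mult_mono_cord) (simp add: succ_le_iff)
  finally show ?thesis .
qed

text \<open>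
  As \<open>\<omega>^a\<close> is a limit, the order of \<open>p\<close> in \<open>N\<close> is already below some \<open>y < \<omega>^a\<close>, and such a \<open>y\<close> is
  absorbed by \<open>\<omega>^a * c\<close>.
\<close>

lemma derived_Un_small:
  assumes "a \<noteq> 0" "p \<in> derived (M \<union> N) (\<omega> ^\<^sub>o a * c)" "p \<notin> derived N (\<omega> ^\<^sub>o a)"
  shows "p \<in> derived M (\<omega> ^\<^sub>o a * c)"
proof -
  obtain y where y: "y < \<omega> ^\<^sub>o a" "p \<notin> derived N y"
    using assms(3) in_derived_limitI limit_succ_less[OF is_limit_oexp[OF assms(1)]] by blast
  show ?thesis
  proof (rule in_derived_limitI)
    fix x assume x: "x < \<omega> ^\<^sub>o a * c"
    then show "succ x < \<omega> ^\<^sub>o a * c" by (rule succ_less_oexp_times[OF assms(1)])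
    have "nsum x y < \<omega> ^\<^sub>o a * c" using x y(1) by (rule nsum_less_oexp_times)
    then have "p \<in> derived (M \<union> N) (nsum x y)"
      using assms(2) derived_antimono[OF less_imp_le] by blast
    then show "p \<in> derived M x" using derived_Un_nsum y(2) by blast
  qed
qed

lemma derived_Diff_finite:
  assumes "a \<noteq> 0" "finite F" "\<And>x p. x \<in> F \<Longrightarrow> p \<notin> derived (N x) (\<omega> ^\<^sub>o a)"
    and "p \<in> derived D (\<omega> ^\<^sub>o a * c)"
  shows "p \<in> derived (D - (\<Union>x\<in>F. N x)) (\<omega> ^\<^sub>o a * c)"
  using assms(2,3)
proof (induction F)
  case empty
  then show ?case using assms(4) by simp
next
  case (insert x F)
  let ?A = "D - (\<Union>x\<in>F. N x)"
  have "p \<in> derived ?A (\<omega> ^\<^sub>o a * c)" using insert by auto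
  moreover have "?A \<subseteq> (D - (\<Union>x\<in>insert x F. N x)) \<union> N x" by auto
  ultimately have "p \<in> derived ((D - (\<Union>x\<in>insert x F. N x)) \<union> N x) (\<omega> ^\<^sub>o a * c)"
    using derived_mono by blast
  then show ?case using derived_Un_small[OF assms(1)] insert.prems by blast
qed

text \<open>
  The points \<open>b + \<omega>^d\<close> with \<open>b < a + \<omega>^c\<close> and \<open>d < c\<close> have order \<open>d\<close> by induction, and by
  indecomposability they lie below \<open>a + \<omega>^c\<close>, cofinally.
\<close>

lemma add_oexp_in_derived:
  assumes "a + \<omega> ^\<^sub>o c \<le> t" shows "a + \<omega> ^\<^sub>o c \<in> derived {..<t} c"
  using assms
proof (induction c arbitrary: a rule: less_induct)
  case (less c)
  show ?case unfolding in_derived_iff islimpt_cord_iff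
  proof (intro allI impI conjI)
    fix d assume d: "d < c"
    have "a < a + \<omega> ^\<^sub>o c" using add_strict_mono[of 0 "\<omega> ^\<^sub>o c" a] oexp_omega_pos[of c]
      by (simp add: plus_cord_rec(1,2) cord_zero_less_iff)
    then show "a + \<omega> ^\<^sub>o c \<noteq> 0" by auto
    fix b assume b: "b < a + \<omega> ^\<^sub>o c"
    have *: "b + \<omega> ^\<^sub>o d < a + \<omega> ^\<^sub>o c" by (rule add_oexp_less[OF b d])
    moreover have "b < b + \<omega> ^\<^sub>o d" using add_strict_mono[of 0 "\<omega> ^\<^sub>o d" b] oexp_omega_pos[of d]
      by (simp add: plus_cord_rec(1,2) cord_zero_less_iff)
    moreover have "b + \<omega> ^\<^sub>o d \<in> derived {..<t} d"
      using less.IH[OF d, of b] * less.prems by simp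
    ultimately show "\<exists>q\<in>{..<t} \<inter> derived {..<t} d. b < q \<and> q < a + \<omega> ^\<^sub>o c"
      using less.prems by (intro bexI[of _ "b + \<omega> ^\<^sub>o d"]) auto
  qed
qed

section \<open>A generic independent set\<close>

lemma enumerate_infinitely_often:
  assumes "countable A" "A \<noteq> {}"
  obtains e :: "nat \<Rightarrow> 'a" where "range e \<subseteq> A" "\<And>a m. a \<in> A \<Longrightarrow> \<exists>n\<ge>m. e n = a"
proof
  let ?e = "\<lambda>n. from_nat_into A (snd (prod_decode n))"
  show "range ?e \<subseteq> A" using from_nat_into[OF assms(2)] by blast
  fix a m assume "a \<in> A"
  then obtain i where "from_nat_into A i = a" using from_nat_into_surj[OF assms(1)] by blast
  then show "\<exists>n\<ge>m. ?e n = a"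
    by (intro exI[of _ "prod_encode (m, i)"]) (simp add: le_prod_encode_1)
qed

text \<open>
  Here \<open>N x\<close> is the neighbourhood of \<open>x\<close> in a graph, and \<open>g\<close> translates target orders into orders
  that survive the deletion of finitely many neighbourhoods.  The conditions \<open>S\<close> in the proof are finite
  independent sets of points labelled with target orders.  A requirement \<open>(x, c, d, b)\<close> asks for a
  point labelled \<open>d < c\<close> in the interval from \<open>b\<close> to \<open>x\<close>, where \<open>x\<close> is labelled \<open>c\<close>; the point \<open>t\<close>
  with label \<open>\<beta>\<close> is always available for requirements but never becomes a member of the set.
\<close>

lemma generic_independent_set:
  fixes N :: "cord \<Rightarrow> cord set"
  assumes F: "\<And>F p c. finite F \<Longrightarrow> p \<in> derived {..<t} (g c) \<Longrightarrow>
        p \<in> derived ({..<t} - (\<Union>x\<in>F. N x)) (g c)"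
    and g: "\<And>c d. c < d \<Longrightarrow> g c < g d"
    and sym: "\<And>x y. y \<in> N x \<Longrightarrow> x \<in> N y" and irr: "\<And>x. x \<notin> N x"
    and t: "t \<in> derived {..<t} (g \<beta>)"
  obtains X where "X \<subseteq> {..<t}" "\<And>x y. x \<in> X \<Longrightarrow> y \<in> X \<Longrightarrow> y \<notin> N x" "t \<in> derived X \<beta>"
proof -
  define good where "good S \<longleftrightarrow> finite S \<and> (\<forall>(x, c)\<in>S. x < t \<and> c \<le> \<beta> \<and> x \<in> derived {..<t} (g c)) \<and>
      (\<forall>x\<in>fst ` S. \<forall>y\<in>fst ` S. y \<notin> N x)" for S :: "(cord \<times> cord) set"
  define meets where "meets S S' \<tau> \<longleftrightarrow> (case \<tau> of (x, c, d, b) \<Rightarrow>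
      (x, c) \<in> insert (t, \<beta>) S \<longrightarrow> d < c \<longrightarrow> b < x \<longrightarrow> (\<exists>q. (q, d) \<in> S' \<and> b < q \<and> q < x))"
    for S S' :: "(cord \<times> cord) set" and \<tau>
  have ext: "\<exists>S'. good S' \<and> S \<subseteq> S' \<and> meets S S' \<tau>" if S: "good S" for S \<tau>
  proof (cases \<tau>)
    case (fields x c d b)
    show ?thesis
    proof (cases "(x, c) \<in> insert (t, \<beta>) S \<and> d < c \<and> b < x")
      case False
      then show ?thesis using S fields by (intro exI[of _ S]) (auto simp: meets_def)
    next
      case True
      let ?A = "{..<t} - (\<Union>x\<in>fst ` S. N x)"
      have x: "x \<in> derived {..<t} (g c)" "x \<le> t" "c \<le> \<beta>"
        using True S t by (auto simp: good_def)
      have "x \<in> derived ?A (g c)"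
        using S x by (intro F) (auto simp: good_def)
      then have "x islimpt (?A \<inter> derived ?A (g d))" using g True by (simp add: in_derived_iff)
      then obtain q where q: "q \<in> ?A" "q \<in> derived ?A (g d)" "b < q" "q < x"
        using True by (auto simp: islimpt_cord_iff)
      have qd: "q \<in> derived {..<t} (g d)" using q(2) derived_mono[of ?A "{..<t}"] by blast
      have "q \<notin> N y" "y \<notin> N q" if "y \<in> fst ` S" for y using q(1) that sym by blast+
      then have "good (insert (q, d) S)"
        using S q qd irr x True unfolding good_def by auto
      then show ?thesis using q fields by (intro exI[of _ "insert (q, d) S"]) (auto simp: meets_def)
    qed
  qed
  define T where "T = {..t} \<times> {..\<beta>} \<times> {..\<beta>} \<times> {..t}"
  have "{..x} = {..<succ x}" for x by (auto simp: less_succ_iff)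
  then have c: "countable {..x}" for x :: cord by (simp add: countable_lessThan_cord)
  then have cT: "countable T" unfolding T_def by (intro countable_SIGMA c)
  have "T \<noteq> {}" by (auto simp: T_def)
  then obtain e :: "nat \<Rightarrow> cord \<times> cord \<times> cord \<times> cord" where "range e \<subseteq> T" and e: "\<And>\<tau> m. \<tau> \<in> T \<Longrightarrow> \<exists>n\<ge>m. e n = \<tau>"
    by (rule enumerate_infinitely_often[OF cT]) (rule that)
  have g0: "good {}" by (simp add: good_def)
  have "\<exists>S. \<forall>n. good (S n) \<and> (S n \<subseteq> S (Suc n) \<and> meets (S n) (S (Suc n)) (e n))"
    by (rule dependent_nat_choice) (use g0 ext in blast)+
  then obtain S where "\<forall>n. good (S n) \<and> (S n \<subseteq> S (Suc n) \<and> meets (S n) (S (Suc n)) (e n))" ..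
  then have S: "good (S n)" "S n \<subseteq> S (Suc n)" "meets (S n) (S (Suc n)) (e n)" for n
    by simp_all
  have inc: "S m \<subseteq> S n" if "m \<le> n" for m n
    using S(2) that by (rule lift_Suc_mono_le)
  define U where "U = (\<Union>n. S n)"
  define X where "X = fst ` U"
  have Xt: "X \<subseteq> {..<t}" using S(1) by (fastforce simp: X_def U_def good_def)
  \<comment> \<open>A requirement may come up before its point \<open>x\<close> has been chosen, so each one has to be enumerated
    infinitely often.\<close>
  have dU: "x \<in> derived X c" if "(x, c) \<in> insert (t, \<beta>) U" for x c
    using that
  proof (induction c arbitrary: x rule: less_induct)
    case (less c)
    have x: "x \<le> t" "c \<le> \<beta>" "x \<in> derived {..<t} (g c)"
      using less.prems S(1) t by (fastforce simp: U_def good_def)+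
    show ?case unfolding in_derived_iff islimpt_cord_iff
    proof (intro allI impI conjI)
      fix d assume d: "d < c"
      have "x islimpt ({..<t} \<inter> derived {..<t} (g d))" using x(3) g[OF d] by (simp add: in_derived_iff)
      then show "x \<noteq> 0" by (simp add: islimpt_cord_iff)
      fix b assume b: "b < x"
      obtain m where m: "(x, c) \<in> insert (t, \<beta>) (S m)" using less.prems by (auto simp: U_def)
      have "(x, c, d, b) \<in> T" using x b d by (auto simp: T_def)
      then obtain n where n: "m \<le> n" "e n = (x, c, d, b)" using e by blast
      then obtain q where q: "(q, d) \<in> S (Suc n)" "b < q" "q < x"
        using S(3)[of n] m d b inc[OF n(1)] by (auto simp: meets_def)
      then have "q \<in> X" "q \<in> derived X d" using less.IH[OF d, of q] by (force simp: X_def U_def)+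
      then show "\<exists>q\<in>X \<inter> derived X d. b < q \<and> q < x" using q by blast
    qed
  qed
  have "y \<notin> N x" if xy: "x \<in> X" "y \<in> X" for x y
  proof -
    obtain m n where "x \<in> fst ` S m" "y \<in> fst ` S n" using xy by (auto simp: X_def U_def)
    then have "x \<in> fst ` S (max m n)" "y \<in> fst ` S (max m n)"
      using inc[of m "max m n"] inc[of n "max m n"] by auto
    then show ?thesis using S(1)[of "max m n"] by (auto simp: good_def)
  qed
  then show thesis using that[OF Xt] dU by blast
qed

section \<open>Copies of powers of \<open>\<omega>\<close>\<close>

text \<open>
  A strictly increasing map on the closed interval from \<open>a\<close> to \<open>u\<close> that preserves suprema, that is, a
  normal function on this interval.
\<close>

definition climbs :: "cord \<Rightarrow> cord \<Rightarrow> (cord \<Rightarrow> cord) \<Rightarrow> bool" where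
  "climbs a u f \<longleftrightarrow> strict_mono_on {a..u} f \<and>
     (\<forall>y. a < y \<longrightarrow> y \<le> u \<longrightarrow> is_limit y \<longrightarrow> (\<forall>z<f y. \<exists>w. a \<le> w \<and> w < y \<and> z < f w))"

lemma climbsD:
  assumes "climbs a u f"
  shows "a \<le> x \<Longrightarrow> x < y \<Longrightarrow> y \<le> u \<Longrightarrow> f x < f y"
    and "a < y \<Longrightarrow> y \<le> u \<Longrightarrow> is_limit y \<Longrightarrow> z < f y \<Longrightarrow> \<exists>w. a \<le> w \<and> w < y \<and> z < f w"
  using assms unfolding climbs_def
  by (auto intro: strict_mono_onD[of "{a..u}" f x y])

lemma locate_step:
  fixes a :: "nat \<Rightarrow> cord"
  assumes "a 0 < y" "y \<le> a k"
  obtains n where "a n < y" "y \<le> a (Suc n)"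
proof -
  define m where "m = (LEAST m. y \<le> a m)"
  have m: "y \<le> a m" unfolding m_def using assms(2) by (rule LeastI)
  then obtain n where n: "m = Suc n" using assms(1) by (cases m) auto
  then have "\<not> y \<le> a n" using not_less_Least[of n "\<lambda>m. y \<le> a m"] by (simp add: m_def)
  then show thesis using that[of n] m n by simp
qed

text \<open>
  Consecutive pieces agree at their common endpoint, so the glued map is determined on
  each piece.  The only new limit point is \<open>u\<close>, where continuity holds because the values at the cut
  points converge to \<open>q\<close>.
\<close>

lemma glue_climbs:
  fixes a p :: "nat \<Rightarrow> cord"
  assumes a: "\<And>n. a n < a (Suc n)" "\<And>n. a n < u" "\<And>y. y < u \<Longrightarrow> \<exists>n. y < a n"
    and p: "\<And>n. p n < q" "\<And>z. z < q \<Longrightarrow> \<exists>n. z < p n"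
    and f: "\<And>n. climbs (a n) (a (Suc n)) (f n)" "\<And>n. f n (a n) = p n"
      "\<And>n. f n (a (Suc n)) = p (Suc n)"
  obtains h where "climbs (a 0) u h" "h u = q"
    "\<And>n y. a n \<le> y \<Longrightarrow> y \<le> a (Suc n) \<Longrightarrow> h y = f n y"
proof -
  have am: "a m < a n" if "m < n" for m n using a(1) that by (rule lift_Suc_mono_less)
  have am': "a m \<le> a n \<longleftrightarrow> m \<le> n" for m n using am[of n m] am[of m n] by (metis le_less linorder_not_le)
  have ps: "p n < p (Suc n)" for n
    using climbsD(1)[OF f(1) order_refl a(1) order_refl, of n] f by simp
  have pm: "p m \<le> p n" if "m \<le> n" for m n using less_imp_le[OF ps] that by (rule lift_Suc_mono_le)
  \<comment> \<open>At \<open>a 0\<close> this index is \<open>0\<close>, so the first piece also determines the value at its left endpoint.\<close>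
  define idx where "idx y = (LEAST n. y \<le> a (Suc n))" for y
  have idx: "idx y = n" if "a n < y" "y \<le> a (Suc n)" for n y
    unfolding idx_def
  proof (rule Least_equality)
    fix m assume "y \<le> a (Suc m)"
    then have "\<not> Suc m \<le> n" using that(1) am'[of "Suc m" n] by auto
    then show "n \<le> m" by simp
  qed (rule that(2))
  define h where "h y = (if y < u then f (idx y) y else q)" for y
  have piece: "h y = f n y" if "a n \<le> y" "y \<le> a (Suc n)" for n y
  proof -
    have yu: "y < u" using that(2) a(2) by (rule le_less_trans)
    show ?thesis
    proof (cases "a n = y")
      case False
      then show ?thesis using idx[of n y] that yu by (simp add: h_def)
    next
      case y: True
      show ?thesis
      proof (cases n)
        case 0
        have "idx y = 0" unfolding idx_def using y 0 a(1)[of 0] by (intro Least_equality) auto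
        then show ?thesis using yu 0 by (simp add: h_def)
      next
        case (Suc m)
        have "idx y = m" using idx[of m y] y Suc a(1)[of m] by simp
        then show ?thesis using yu y Suc f(2)[of n] f(3)[of m] by (simp add: h_def)
      qed
    qed
  qed
  have loc: "\<exists>n. a n < y \<and> y \<le> a (Suc n)" if "a 0 < y" "y < u" for y
    using a(3)[OF that(2)] locate_step[of a y, OF that(1)] by (metis less_imp_le)
  have hle: "h y \<le> p k" if "a 0 \<le> y" and yk: "y \<le> a k" for y k
  proof (cases "y = a 0")
    case True
    then show ?thesis using piece[of 0 y] a(1)[of 0] f(2)[of 0] pm[of 0 k] by (simp add: less_imp_le)
  next
    case False
    then have "a 0 < y" using that by simp
    then obtain n where n: "a n < y" "y \<le> a (Suc n)" using yk by (rule locate_step)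
    then have "Suc n \<le> k" using yk am'[of k n] by (meson less_le_trans linorder_not_le not_less_eq_eq)
    have "h y = f n y" using n piece by simp
    also have "\<dots> \<le> p (Suc n)"
      using climbsD(1)[OF f(1) _ _ order_refl, of n y] n f(3)[of n]
      by (cases "y = a (Suc n)") (auto simp: less_imp_le)
    also have "\<dots> \<le> p k" using \<open>Suc n \<le> k\<close> by (rule pm)
    finally show ?thesis .
  qed
  have "h y < h y'" if y: "a 0 \<le> y" "y < y'" "y' \<le> u" for y y'
  proof (cases "y' = u")
    case True
    obtain n where "y < a n" using a(3)[OF less_le_trans[OF y(2,3)]] by blast
    then have "h y \<le> p n" using hle y by simp
    also have "\<dots> < q" by (rule p(1))
    finally show ?thesis using True by (simp add: h_def)
  next
    case False
    then have "y' < u" using y(3) by simp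
    then obtain n where n: "a n < y'" "y' \<le> a (Suc n)" using loc[OF le_less_trans[OF y(1,2)]] by blast
    have hy': "h y' = f n y'" using n piece by simp
    show ?thesis
    proof (cases "a n \<le> y")
      case True
      then show ?thesis using climbsD(1)[OF f(1) True y(2) n(2)] piece[of n y] y(2) n hy' by simp
    next
      case False
      then have "h y \<le> p n" using hle[of y n] y(1) by simp
      also have "\<dots> < h y'" using climbsD(1)[OF f(1) order_refl n] f(2) hy' by simp
      finally show ?thesis .
    qed
  qed
  then have mono: "strict_mono_on {a 0..u} h" by (auto intro!: strict_mono_onI)
  have lim: "\<exists>w. a 0 \<le> w \<and> w < y \<and> z < h w" if y: "a 0 < y" "y \<le> u" "is_limit y" "z < h y" for y z
  proof (cases "y = u")
    case True
    then obtain n where "z < p n" using y(4) p(2) by (auto simp: h_def)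
    then show ?thesis using piece[of n "a n"] f(2)[of n] a(1)[of n] a(2)[of n] am'[of 0 n] True
      by (intro exI[of _ "a n"]) (simp add: less_imp_le)
  next
    case False
    then have "y < u" using y(2) by simp
    then obtain n where n: "a n < y" "y \<le> a (Suc n)" using loc[OF y(1)] by blast
    then obtain w where w: "a n \<le> w" "w < y" "z < f n w"
      using climbsD(2)[OF f(1) n y(3), of z] y(4) piece[OF less_imp_le[OF n(1)] n(2)] by auto
    moreover have "h w = f n w" using w n by (intro piece) auto
    moreover have "a 0 \<le> w" using am'[of 0 n] w(1) by (meson order_trans le0)
    ultimately show ?thesis by auto
  qed
  have "climbs (a 0) u h" unfolding climbs_def using mono lim by blast
  then show thesis using that[of h] piece by (simp add: h_def)
qed

text \<open>
  The interval from \<open>a\<close> to \<open>a + \<omega>^c\<close> is cut at points \<open>s n\<close> whose consecutive distances are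
  \<open>\<omega>^(e n)\<close>, where \<open>e\<close> lists each \<open>d < c\<close> infinitely often; this makes them cofinal whether \<open>c\<close>
  is a successor or a limit.  On the other side, starting from \<open>r 0 = b\<close>, points \<open>r (n + 1)\<close> of \<open>X\<close>
  of order \<open>e n\<close> are chosen so that they increase and converge to \<open>p\<close>.  The induction
  hypothesis fills the gaps.
\<close>

lemma climb_through_derived:
  assumes "p \<in> derived X c" "b < p"
  shows "\<exists>f. climbs a (a + \<omega> ^\<^sub>o c) f \<and> f a = b \<and> f (a + \<omega> ^\<^sub>o c) = p \<and>
    (\<forall>y. a < y \<longrightarrow> y < a + \<omega> ^\<^sub>o c \<longrightarrow> f y \<in> X)"
  using assms
proof (induction c arbitrary: a b p rule: less_induct)
  case (less c)
  let ?u = "a + \<omega> ^\<^sub>o c"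
  show ?case
  proof (cases "c = 0")
    case True
    then have u: "?u = succ a"
      by (simp add: oexp_rec one_cord_def plus_cord_rec(1,2))
    have ends: "x = a \<and> y = succ a" if "a \<le> x" "x < y" "y \<le> succ a" for x y
      using that by (meson less_le_trans less_succ_iff order_antisym order_less_imp_le succ_le_iff order_trans)
    have "strict_mono_on {a..succ a} (\<lambda>y. if y = a then b else p)"
      using ends less.prems(2) less_succ[of a] by (intro strict_mono_onI) (metis atLeastAtMost_iff order_less_irrefl)
    moreover have "\<not> is_limit y" if "a < y" "y \<le> succ a" for y
      using ends[OF order_refl that] by (auto simp: is_limit_def)
    ultimately have "climbs a (succ a) (\<lambda>y. if y = a then b else p)"
      unfolding climbs_def by blast
    then show ?thesis unfolding u using less_imp_neq[OF less_succ[of a]]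
      by (intro exI[of _ "\<lambda>y. if y = a then b else p"]) (auto simp: less_succ_iff)
  next
    case False
    have "{..<c} \<noteq> {}" "{..<p} \<noteq> {}"
      using False less.prems(2) by (auto simp: cord_zero_less_iff[symmetric])
    then obtain e b' :: "nat \<Rightarrow> cord"
      where e: "range e \<subseteq> {..<c}" "\<And>d m. d \<in> {..<c} \<Longrightarrow> \<exists>n\<ge>m. e n = d"
        and b': "range b' \<subseteq> {..<p}" "\<And>d m. d \<in> {..<p} \<Longrightarrow> \<exists>n\<ge>m. b' n = d"
      using enumerate_infinitely_often[OF countable_lessThan_cord] by metis
    have ec: "e n < c" and bp: "b' n < p" for n using e(1) b'(1) by auto
    define s where "s = rec_nat a (\<lambda>n v. v + \<omega> ^\<^sub>o e n)"
    have s0: "s 0 = a" and sS: "s (Suc n) = s n + \<omega> ^\<^sub>o e n" for n by (simp_all add: s_def)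
    have au: "a < ?u" using add_strict_mono[of 0 "\<omega> ^\<^sub>o c" a] oexp_omega_pos[of c]
      by (simp add: plus_cord_rec(1,2) cord_zero_less_iff)
    have su: "s n < ?u" for n
      by (induction n) (simp_all add: s0 au sS add_oexp_less ec)
    have ss: "s n < s (Suc n)" for n
      using add_strict_mono[of 0 "\<omega> ^\<^sub>o e n" "s n"] oexp_omega_pos[of "e n"]
      by (simp add: sS plus_cord_rec(1,2) cord_zero_less_iff)
    have scof: "\<exists>n. y < s n" if y: "y < ?u" for y
    proof -
      obtain d m where d: "d < c" "y < ((\<lambda>v. v + \<omega> ^\<^sub>o d) ^^ m) a"
        using less_add_oexp[OF y False] by blast
      have "\<exists>n. ((\<lambda>v. v + \<omega> ^\<^sub>o d) ^^ i) a \<le> s n" for i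
      proof (induction i)
        case 0 then show ?case using s0 by (intro exI[of _ 0]) simp
      next
        case (Suc i)
        then obtain n where n: "((\<lambda>v. v + \<omega> ^\<^sub>o d) ^^ i) a \<le> s n" by blast
        obtain k where k: "n \<le> k" "e k = d" using e(2)[of d n] d(1) by auto
        have "s n \<le> s k" using less_imp_le[OF ss] k(1) by (rule lift_Suc_mono_le)
        then show ?case using add_right_mono_cord[OF order_trans[OF n], of "s k" "\<omega> ^\<^sub>o d"] k(2)
          by (intro exI[of _ "Suc k"]) (simp add: sS)
      qed
      then show ?thesis using d(2) less_le_trans by blast
    qed
    have "\<exists>r. \<forall>n. (r n < p \<and> (n = 0 \<longrightarrow> r n = b)) \<and>
        (r n < r (Suc n) \<and> b' n < r (Suc n) \<and> r (Suc n) \<in> X \<inter> derived X (e n))"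
    proof (rule dependent_nat_choice)
      show "\<exists>x. x < p \<and> (0 = (0::nat) \<longrightarrow> x = b)" using less.prems(2) by blast
      fix x and n :: nat assume "x < p \<and> (n = 0 \<longrightarrow> x = b)"
      then have "max x (b' n) < p" using bp by simp
      moreover have "p islimpt (X \<inter> derived X (e n))"
        using less.prems(1) ec by (simp add: in_derived_iff)
      ultimately obtain y where "y \<in> X \<inter> derived X (e n)" "max x (b' n) < y" "y < p"
        unfolding islimpt_cord_iff by blast
      then show "\<exists>y. (y < p \<and> (Suc n = 0 \<longrightarrow> y = b)) \<and>
          (x < y \<and> b' n < y \<and> y \<in> X \<inter> derived X (e n))" by auto
    qed
    then obtain r where r: "\<And>n. r n < p" "r 0 = b" "\<And>n. r n < r (Suc n)" "\<And>n. b' n < r (Suc n)"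
        "\<And>n. r (Suc n) \<in> X" "\<And>n. r (Suc n) \<in> derived X (e n)" by blast
    have rcof: "\<exists>n. z < r n" if "z < p" for z using b'(2)[of z 0] r(4) that by auto
    have "\<exists>f. climbs (s n) (s (Suc n)) f \<and> f (s n) = r n \<and> f (s (Suc n)) = r (Suc n) \<and>
        (\<forall>y. s n < y \<longrightarrow> y < s (Suc n) \<longrightarrow> f y \<in> X)" for n
      unfolding sS by (rule less.IH[OF ec r(6,3)])
    then obtain f where f: "\<And>n. climbs (s n) (s (Suc n)) (f n)" "\<And>n. f n (s n) = r n"
        "\<And>n. f n (s (Suc n)) = r (Suc n)"
        "\<And>n y. s n < y \<Longrightarrow> y < s (Suc n) \<Longrightarrow> f n y \<in> X" by metis
    obtain h where h: "climbs (s 0) ?u h" "h ?u = p"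
        "\<And>n y. s n \<le> y \<Longrightarrow> y \<le> s (Suc n) \<Longrightarrow> h y = f n y"
      using glue_climbs[OF ss su scof r(1) rcof f(1,2,3)] by blast
    have "h a = b" using h(3)[of 0 a] f(2)[of 0] s0 r(2) ss[of 0] by simp
    moreover have "h y \<in> X" if y: "a < y" "y < ?u" for y
    proof -
      obtain k where "y < s k" using scof[OF y(2)] by blast
      then have "s 0 < y" "y \<le> s k" using y(1) s0 by auto
      then obtain n where n: "s n < y" "y \<le> s (Suc n)" by (rule locate_step)
      then have "h y = f n y" using h(3) by simp
      then show ?thesis using f(3,4)[of n] r(5)[of n] n by (cases "y = s (Suc n)") auto
    qed
    ultimately show ?thesis using h s0 by (intro exI[of _ h]) simp
  qed
qed

text \<open>
  Strict monotonicity alone makes the inverse continuous for the subspace topology; continuity of the map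
  itself needs the condition on suprema at limit points only.
\<close>

lemma climbs_homeomorphic:
  assumes f: "climbs 0 u f"
  shows "f ` {..<u} homeomorphic {..<u}"
proof -
  let ?S = "{..<u}"
  have less: "f x < f y \<longleftrightarrow> x < y" if "x < u" "y < u" for x y
    using climbsD(1)[OF f, of x y] climbsD(1)[OF f, of y x] that
    by (cases x y rule: linorder_cases) (auto simp: less_imp_le)
  have inj: "inj_on f ?S" using less by (metis inj_onI lessThan_iff linorder_neqE order_less_irrefl)
  define g where "g = inv_into ?S f"
  have gf: "g (f x) = x" if "x < u" for x using inj that by (simp add: g_def inv_into_f_f)
  have "continuous_on ?S f"
    unfolding continuous_on_def
  proof
    fix x assume x: "x \<in> ?S"
    show "(f \<longlongrightarrow> f x) (at x within ?S)"
    proof (rule order_tendstoI)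
      fix z assume z: "z < f x"
      have "\<exists>T. open T \<and> x \<in> T \<and> (\<forall>v\<in>T. v \<noteq> x \<longrightarrow> v < u \<longrightarrow> z < f v)"
      proof (cases x rule: cord_cases)
        case 1
        then show ?thesis using less z x by (intro exI[of _ UNIV]) (auto simp: cord_zero_less_iff intro: less_trans)
      next
        case (2 y)
        have "z < f v" if "y < v" "v \<noteq> x" "v < u" for v
        proof -
          have "x < v" using that 2 by (metis succ_le_iff order_le_less)
          then show ?thesis using less[of x v] x that z by (auto intro: less_trans)
        qed
        then show ?thesis using 2 less_succ by (intro exI[of _ "{y<..}"]) auto
      next
        case 3
        then have "0 < x" by (simp add: is_limit_def cord_zero_less_iff)
        then obtain w where w: "w < x" "z < f w" using climbsD(2)[OF f _ _ 3 z] x by (auto simp: less_imp_le)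
        have "z < f v" if "w < v" "v < u" for v
          using less[of w v] that w by (auto intro: less_trans)
        then show ?thesis using w by (intro exI[of _ "{w<..}"]) auto
      qed
      then show "\<forall>\<^sub>F v in at x within ?S. z < f v" by (simp add: eventually_at_topological)
    next
      fix z assume z: "f x < z"
      have "f v < z" if "v < succ x" "v \<noteq> x" "v < u" for v
        using less[of v x] that x z by (auto simp: less_succ_iff order_le_less intro: less_trans)
      then show "\<forall>\<^sub>F v in at x within ?S. f v < z"
        unfolding eventually_at_topological by (intro exI[of _ "{..<succ x}"]) (auto simp: less_succ)
    qed
  qed
  moreover have "continuous_on (f ` ?S) g"
    unfolding continuous_on_def
  proof
    fix v assume "v \<in> f ` ?S"
    then obtain x where x: "x < u" "v = f x" by auto
    show "(g \<longlongrightarrow> g v) (at v within f ` ?S)"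
    proof (rule order_tendstoI)
      fix z assume "z < g v"
      then have z: "z < x" using x gf by simp
      then show "\<forall>\<^sub>F w in at v within f ` ?S. z < g w"
        unfolding eventually_at_topological using x less gf
        by (intro exI[of _ "{f z<..}"]) (auto dest: less_trans)
    next
      fix z assume "g v < z"
      then have z: "x < z" using x gf by simp
      show "\<forall>\<^sub>F w in at v within f ` ?S. g w < z"
      proof (cases "z < u")
        case True
        then show ?thesis unfolding eventually_at_topological using x z less gf
          by (intro exI[of _ "{..<f z}"]) auto
      next
        case False
        then show ?thesis unfolding eventually_at_topological using gf
          by (intro exI[of _ UNIV]) auto
      qed
    qed
  qed
  moreover have "g ` f ` ?S = ?S" using gf by force
  ultimately have "?S homeomorphic f ` ?S"
    using gf by (intro homeomorphicI[of f _ _ g]) auto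
  then show ?thesis by (subst homeomorphic_sym)
qed

lemma copy_in_derived:
  assumes p: "p \<in> derived X c" and c: "c \<noteq> 0"
  obtains Y where "Y \<subseteq> X" "Y homeomorphic {..<\<omega> ^\<^sub>o c}"
proof -
  have "p islimpt (X \<inter> derived X 0)" using p c by (simp add: in_derived_iff[of p X c] cord_zero_less_iff)
  then have "\<exists>b\<in>X. b < p" unfolding islimpt_cord_iff cord_zero_less_iff[symmetric] by blast
  then obtain b where b: "b \<in> X" "b < p" by blast
  obtain f where f: "climbs 0 (\<omega> ^\<^sub>o c) f" "f 0 = b" "\<And>y. 0 < y \<Longrightarrow> y < \<omega> ^\<^sub>o c \<Longrightarrow> f y \<in> X"
    using climb_through_derived[OF p b(2), of 0] by (auto simp: add_0_left_cord)
  have "f ` {..<\<omega> ^\<^sub>o c} \<subseteq> X"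
  proof
    fix v assume "v \<in> f ` {..<\<omega> ^\<^sub>o c}"
    then obtain y where "y < \<omega> ^\<^sub>o c" "v = f y" by auto
    then show "v \<in> X" using f(2,3) b(1) by (cases "y = 0") (auto simp: cord_zero_less_iff)
  qed
  then show thesis using that climbs_homeomorphic[OF f(1)] by blast
qed

section \<open>The partition relation\<close>

theorem theorem10p2:
  fixes \<alpha> \<beta> :: cord and k :: nat
  assumes "\<alpha> \<noteq> 0" and "\<beta> \<noteq> 0" and "k > 1"
    and "top_arrow (\<omega> ^\<^sub>o (\<omega> ^\<^sub>o \<alpha>)) (\<omega> ^\<^sub>o \<beta>) k"
  shows "top_arrow (\<omega> ^\<^sub>o (\<omega> ^\<^sub>o \<alpha> * \<beta>)) (\<omega> ^\<^sub>o \<beta>) (k + 1)"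
  unfolding top_arrow_def
proof
  fix c :: "cord set \<Rightarrow> colour"
  let ?t = "\<omega> ^\<^sub>o (\<omega> ^\<^sub>o \<alpha> * \<beta>)" and ?A = "{..<\<omega> ^\<^sub>o (\<omega> ^\<^sub>o \<alpha>)}"
  let ?red = "\<exists>X. X \<subseteq> {..<?t} \<and> X homeomorphic {..<\<omega> ^\<^sub>o \<beta>} \<and> (\<forall>e\<in>[X]\<^bsup>2\<^esup>. c e = Red)"
  let ?blue = "\<exists>Y\<in>nsets {..<?t} (k + 1). \<forall>e\<in>[Y]\<^bsup>2\<^esup>. c e = Blue"
  define N where "N x = {y. x < ?t \<and> y < ?t \<and> y \<noteq> x \<and> c {x, y} = Blue}" for x
  show "?red \<or> ?blue"
  proof (cases "\<exists>x p. p \<in> derived (N x) (\<omega> ^\<^sub>o \<alpha>)")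
    case True
    then obtain x Y where Y: "Y \<subseteq> N x" "Y homeomorphic ?A"
      using copy_in_derived oexp_omega_pos by metis
    then obtain f g where fg: "homeomorphism ?A Y f g"
      using homeomorphic_sym homeomorphic_def by metis
    have fN: "f v \<in> N x" if "v \<in> ?A" for v
      using fg that Y(1) by (auto simp: homeomorphism_def)
    have inj: "inj_on f ?A" using fg by (metis homeomorphism_def inj_on_inverseI)
    have pair: "\<exists>e\<in>[Z]\<^bsup>2\<^esup>. e' = f ` e" if e': "e' \<in> [f ` Z]\<^bsup>2\<^esup>" for e' Z
    proof -
      obtain u v where "e' = {f u, f v}" "u \<in> Z" "v \<in> Z" "f u \<noteq> f v"
        using e' by (elim nsets2_E) auto
      then show ?thesis by (intro bexI[of _ "{u, v}"]) (auto simp: nsets_def card_2_iff)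
    qed
    from assms(4)[unfolded top_arrow_def, rule_format, of "\<lambda>e. c (f ` e)"]
    show ?thesis
    proof
      assume "\<exists>X. X \<subseteq> ?A \<and> X homeomorphic {..<\<omega> ^\<^sub>o \<beta>} \<and> (\<forall>e\<in>[X]\<^bsup>2\<^esup>. c (f ` e) = Red)"
      then obtain X where X: "X \<subseteq> ?A" "X homeomorphic {..<\<omega> ^\<^sub>o \<beta>}" "\<forall>e\<in>[X]\<^bsup>2\<^esup>. c (f ` e) = Red"
        by blast
      have "X homeomorphic f ` X"
        using homeomorphism_of_subsets[OF fg X(1) order_refl refl] homeomorphic_def by blast
      then have "f ` X homeomorphic {..<\<omega> ^\<^sub>o \<beta>}"
        using X(2) homeomorphic_trans homeomorphic_sym[of X] by metis
      moreover have "f ` X \<subseteq> {..<?t}" using X(1) fN by (auto simp: N_def)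
      moreover have "\<forall>e\<in>[f ` X]\<^bsup>2\<^esup>. c e = Red" using X(3) pair by metis
      ultimately show ?thesis by (intro disjI1 exI[of _ "f ` X"] conjI)
    next
      assume "\<exists>Z\<in>[?A]\<^bsup>k\<^esup>. \<forall>e\<in>[Z]\<^bsup>2\<^esup>. c (f ` e) = Blue"
      then obtain Z where Z: "Z \<subseteq> ?A" "finite Z" "card Z = k" "\<forall>e\<in>[Z]\<^bsup>2\<^esup>. c (f ` e) = Blue"
        by (auto simp: nsets_def)
      have ZN: "f ` Z \<subseteq> N x" using Z(1) fN by blast
      then have xZ: "x \<notin> f ` Z" by (auto simp: N_def)
      have "Z \<noteq> {}" using Z(3) assms(3) by auto
      then have xt: "x < ?t" using ZN by (auto simp: N_def)
      have "card (f ` Z) = k" using Z(1,3) inj by (metis card_image inj_on_subset)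
      then have "insert x (f ` Z) \<in> nsets {..<?t} (k + 1)"
        using Z(2) ZN xZ xt by (auto simp: nsets_def N_def)
      moreover have "c e = Blue" if e: "e \<in> [insert x (f ` Z)]\<^bsup>2\<^esup>" for e
      proof (cases "x \<in> e")
        case True
        then obtain y where "e = {x, y}" "y \<in> f ` Z"
          using e by (elim nsets2_E) (auto simp: insert_commute)
        then show ?thesis using ZN by (auto simp: N_def)
      next
        case False
        then have "e \<in> [f ` Z]\<^bsup>2\<^esup>" using e by (auto simp: nsets_def)
        then show ?thesis using pair Z(4) by metis
      qed
      ultimately show ?thesis by (intro disjI2 bexI[of _ "insert x (f ` Z)"] ballI)
    qed
  next
    case False
    have "?t \<in> derived {..<?t} (\<omega> ^\<^sub>o \<alpha> * \<beta>)"
      using add_oexp_in_derived[of 0 "\<omega> ^\<^sub>o \<alpha> * \<beta>"] by (simp add: add_0_left_cord)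
    then have top: "?t \<in> derived {..<?t} (\<omega> ^\<^sub>o \<alpha> * \<beta>)" .
    have avoid: "p \<in> derived ({..<?t} - (\<Union>x\<in>F. N x)) (\<omega> ^\<^sub>o \<alpha> * d)"
      if "finite F" "p \<in> derived {..<?t} (\<omega> ^\<^sub>o \<alpha> * d)" for F p d
      using derived_Diff_finite[OF assms(1) that(1) _ that(2)] False by blast
    have mono: "\<omega> ^\<^sub>o \<alpha> * d < \<omega> ^\<^sub>o \<alpha> * d'" if "d < d'" for d d'
      using oexp_omega_pos that by (rule mult_strict_mono_cord)
    have sym: "x \<in> N y" if "y \<in> N x" for x y using that by (auto simp: N_def insert_commute)
    have irr: "x \<notin> N x" for x by (simp add: N_def)
    obtain X where X: "X \<subseteq> {..<?t}" "\<And>x y. x \<in> X \<Longrightarrow> y \<in> X \<Longrightarrow> y \<notin> N x" "?t \<in> derived X \<beta>"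
      by (rule generic_independent_set
        [where g = "\<lambda>d. \<omega> ^\<^sub>o \<alpha> * d" and N = N, OF avoid mono sym irr top]) (assumption | rule that)+
    obtain Y where Y: "Y \<subseteq> X" "Y homeomorphic {..<\<omega> ^\<^sub>o \<beta>}"
      using copy_in_derived[OF X(3) assms(2)] .
    have "c e = Red" if e: "e \<in> [Y]\<^bsup>2\<^esup>" for e
    proof -
      obtain u v where uv: "e = {u, v}" "u \<in> Y" "v \<in> Y" "u \<noteq> v" using e by (elim nsets2_E)
      then have "v \<notin> N u" "u < ?t" "v < ?t" using X Y(1) by blast+
      then have "c e \<noteq> Blue" using uv by (simp add: N_def)
      then show ?thesis by (cases "c e") auto
    qed
    then show ?thesis
      using X(1) Y by (intro disjI1 exI[of _ Y] conjI ballI) auto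
  qed
qed

end
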